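(* Let $\Delta=(\Delta^+,\Delta^-,\delta^* )$ be a thick twin building of type $(W,S)$ and let $\theta$ be an automorphism of $\Delta$ which interchanges the two halves $\Delta^+$ and $\Delta^-$. Then there is a spherical residue $R$ of $\Delta$ such that $R^\theta$ is opposite $R$.
   Context: $(W,S)$ is a Coxeter system with $S$ finite and $W$ irreducible; $\ell$ denotes length with respect to $S$, and $W_J$ is the subgroup generated by $J\subseteq S$. A twin building of type $(W,S)$ consists of two buildings $\Delta^+,\Delta^-$ of type $(W,S)$ (with $W$-distance $\delta$) and a codistance $\delta^*$ defined on pairs of chambers in different halves, such that for $\epsilon\in\{+,-\}$, $C\in\Delta^\epsilon$, $D\in\Delta^{-\epsilon}$, $w=\delta^*(C,D)$: (Tw1) $\delta^*(D,C)=w^{-1}$; (Tw2) if $E\in\Delta^{-\epsilon}$ with $\delta(D,E)=s\in S$ and $\ell(sw)=\ell(w)-1$ then $\delta^*(C,E)=sw$; (Tw3) for each $s\in S$ there is $E\in\Delta^{-\epsilon}$ with $\delta(D,E)=s$ and $\delta^*(C,E)=sw$. Chambers in the same half are adjacent if $\delta(C,D)\in S$. A $J$-residue ($J\subseteq S$) of $\Delta^\epsilon$ is a set $\{D\in\Delta^\epsilon:\delta(C,D)\in W_J\}$ for some $C\in\Delta^\epsilon$; it is spherical if $W_J$ is finite. Chambers $C,D$ in different halves are opposite if $\delta^*(C,D)=1$; residues $P,Q$ in different halves are opposite if every chamber of $P$ is opposite some chamber of $Q$. An automorphism is a bijection of the chamber set mapping adjacent chambers to adjacent chambers and preserving opposition.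 The twin building is thick if every panel ($\{s\}$-residue) has at least three chambers. *)

theory Defs
  imports "HOL-Algebra.Multiplicative_Group" "HOL-Algebra.Generated_Groups"
begin

definition word_prod :: "('w, 'm) monoid_scheme \<Rightarrow> 'w list \<Rightarrow> 'w" where
  "word_prod W ws = foldr (\<lambda>x y. x \<otimes>\<^bsub>W\<^esub> y) ws \<one>\<^bsub>W\<^esub>"

text \<open>
  The congruence on words over \<open>S\<close> generated by the relators \<open>(st)^m(s,t)\<close>, where \<open>m(s,t)\<close> is the
  order of \<open>st\<close> in \<open>W\<close>. The library assigns order \<open>0\<close> to elements of infinite order, so that
  \<open>m(s,t) = \<infinity>\<close> contributes no relation. The case \<open>s = t\<close> gives the relator \<open>ss\<close>, hence positive
  words suffice to present the group.
\<close>

inductive coxeter_cong :: "('w, 'm) monoid_scheme \<Rightarrow> 'w set \<Rightarrow> 'w list \<Rightarrow> 'w list \<Rightarrow> bool"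
  for W and S where
  refl: "u \<in> lists S \<Longrightarrow> coxeter_cong W S u u"
| sym: "coxeter_cong W S u v \<Longrightarrow> coxeter_cong W S v u"
| trans: "coxeter_cong W S u v \<Longrightarrow> coxeter_cong W S v w \<Longrightarrow> coxeter_cong W S u w"
| relator: "u \<in> lists S \<Longrightarrow> v \<in> lists S \<Longrightarrow> s \<in> S \<Longrightarrow> t \<in> S \<Longrightarrow>
    coxeter_cong W S (u @ concat (replicate (group.ord W (s \<otimes>\<^bsub>W\<^esub> t)) [s, t]) @ v) (u @ v)"

text \<open>\<open>W\<close> is presented by the involutions \<open>S\<close> subject to the relations \<open>(st)^m(s,t) = 1\<close>.\<close>

locale coxeter_system = group W for W :: "('w, 'm) monoid_scheme" (structure) +
  fixes S :: "'w set"
  assumes S_subset: "S \<subseteq> carrier W"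
    and S_generates: "generate W S = carrier W"
    and S_order_two: "s \<in> S \<Longrightarrow> group.ord W s = 2"
    and presentation: "u \<in> lists S \<Longrightarrow> v \<in> lists S \<Longrightarrow> word_prod W u = word_prod W v \<Longrightarrow>
      coxeter_cong W S u v"

definition cox_length :: "('w, 'm) monoid_scheme \<Rightarrow> 'w set \<Rightarrow> 'w \<Rightarrow> nat" where
  "cox_length W S w = (LEAST n. \<exists>ws \<in> lists S. length ws = n \<and> word_prod W ws = w)"

text \<open>
  Edges of the Coxeter diagram: pairs with \<open>m(s,t) \<ge> 3\<close> or \<open>m(s,t) = \<infinity>\<close>; the latter is order \<open>0\<close>.
\<close>

definition diagram_edges :: "('w, 'm) monoid_scheme \<Rightarrow> 'w set \<Rightarrow> ('w \<times> 'w) set" where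
  "diagram_edges W S = {(s, t). s \<in> S \<and> t \<in> S \<and> group.ord W (s \<otimes>\<^bsub>W\<^esub> t) \<notin> {1, 2}}"

definition irreducible_coxeter :: "('w, 'm) monoid_scheme \<Rightarrow> 'w set \<Rightarrow> bool" where
  "irreducible_coxeter W S \<longleftrightarrow>
     S \<noteq> {} \<and> (\<forall>s \<in> S. \<forall>t \<in> S. (s, t) \<in> (diagram_edges W S)\<^sup>*)"

locale building = coxeter_system W S for W :: "('w, 'm) monoid_scheme" (structure) and S +
  fixes Ch :: "'c set" and \<delta> :: "'c \<Rightarrow> 'c \<Rightarrow> 'w"
  assumes nonempty: "Ch \<noteq> {}"
    and dist_closed: "C \<in> Ch \<Longrightarrow> D \<in> Ch \<Longrightarrow> \<delta> C D \<in> carrier W"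
    and WD1: "C \<in> Ch \<Longrightarrow> D \<in> Ch \<Longrightarrow> \<delta> C D = \<one> \<longleftrightarrow> C = D"
    and WD2: "C \<in> Ch \<Longrightarrow> D \<in> Ch \<Longrightarrow> C' \<in> Ch \<Longrightarrow> s \<in> S \<Longrightarrow> \<delta> C' C = s \<Longrightarrow>
      \<delta> C' D \<in> {s \<otimes> \<delta> C D, \<delta> C D} \<and>
      (cox_length W S (s \<otimes> \<delta> C D) = cox_length W S (\<delta> C D) + 1 \<longrightarrow> \<delta> C' D = s \<otimes> \<delta> C D)"
    and WD3: "C \<in> Ch \<Longrightarrow> D \<in> Ch \<Longrightarrow> s \<in> S \<Longrightarrow>
      \<exists>C' \<in> Ch. \<delta> C' C = s \<and> \<delta> C' D = s \<otimes> \<delta> C D"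

datatype sign = Plus | Minus

fun opp_sign :: "sign \<Rightarrow> sign" where
  "opp_sign Plus = Minus"
| "opp_sign Minus = Plus"

text \<open>
  A single function \<open>\<delta>\<close> carries the Weyl distances of both (disjoint) halves; only its values on
  pairs of chambers in the same half matter, and only values of \<open>\<delta>s\<close> on pairs in different halves.
  The codistance is normalised so that moving its second argument multiplies on the left; this is
  the pointwise inverse of the other common convention.
\<close>

locale twin_building = coxeter_system W S for W :: "('w, 'm) monoid_scheme" (structure) and S +
  fixes \<Delta> :: "sign \<Rightarrow> 'c set"
    and \<delta> :: "'c \<Rightarrow> 'c \<Rightarrow> 'w"
    and \<delta>s :: "'c \<Rightarrow> 'c \<Rightarrow> 'w"
  assumes halves: "building W S (\<Delta> \<epsilon>) \<delta>"
    and disjoint_halves: "\<Delta> Plus \<inter> \<Delta> Minus = {}"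
    and codist_closed: "C \<in> \<Delta> \<epsilon> \<Longrightarrow> D \<in> \<Delta> (opp_sign \<epsilon>) \<Longrightarrow> \<delta>s C D \<in> carrier W"
    and Tw1: "C \<in> \<Delta> \<epsilon> \<Longrightarrow> D \<in> \<Delta> (opp_sign \<epsilon>) \<Longrightarrow> \<delta>s D C = inv (\<delta>s C D)"
    and Tw2: "C \<in> \<Delta> \<epsilon> \<Longrightarrow> D \<in> \<Delta> (opp_sign \<epsilon>) \<Longrightarrow> E \<in> \<Delta> (opp_sign \<epsilon>) \<Longrightarrow> s \<in> S \<Longrightarrow>
      \<delta> D E = s \<Longrightarrow> cox_length W S (s \<otimes> \<delta>s C D) + 1 = cox_length W S (\<delta>s C D) \<Longrightarrow>
      \<delta>s C E = s \<otimes> \<delta>s C D"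
    and Tw3: "C \<in> \<Delta> \<epsilon> \<Longrightarrow> D \<in> \<Delta> (opp_sign \<epsilon>) \<Longrightarrow> s \<in> S \<Longrightarrow>
      \<exists>E \<in> \<Delta> (opp_sign \<epsilon>). \<delta> D E = s \<and> \<delta>s C E = s \<otimes> \<delta>s C D"

definition adjacent ::
  "'w set \<Rightarrow> (sign \<Rightarrow> 'c set) \<Rightarrow> ('c \<Rightarrow> 'c \<Rightarrow> 'w) \<Rightarrow> 'c \<Rightarrow> 'c \<Rightarrow> bool" where
  "adjacent S \<Delta> \<delta> C D \<longleftrightarrow> (\<exists>\<epsilon>. C \<in> \<Delta> \<epsilon> \<and> D \<in> \<Delta> \<epsilon> \<and> \<delta> C D \<in> S)"

definition residue_of_type ::
  "('w, 'm) monoid_scheme \<Rightarrow> (sign \<Rightarrow> 'c set) \<Rightarrow> ('c \<Rightarrow> 'c \<Rightarrow> 'w) \<Rightarrow> sign \<Rightarrow> 'w set \<Rightarrow> 'c set \<Rightarrow> bool"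
  where
  "residue_of_type W \<Delta> \<delta> \<epsilon> J R \<longleftrightarrow> (\<exists>C \<in> \<Delta> \<epsilon>. R = {D \<in> \<Delta> \<epsilon>. \<delta> C D \<in> generate W J})"

definition residue_in ::
  "('w, 'm) monoid_scheme \<Rightarrow> 'w set \<Rightarrow> (sign \<Rightarrow> 'c set) \<Rightarrow> ('c \<Rightarrow> 'c \<Rightarrow> 'w) \<Rightarrow> sign \<Rightarrow> 'c set \<Rightarrow> bool"
  where
  "residue_in W S \<Delta> \<delta> \<epsilon> R \<longleftrightarrow> (\<exists>J. J \<subseteq> S \<and> residue_of_type W \<Delta> \<delta> \<epsilon> J R)"

definition spherical_residue ::
  "('w, 'm) monoid_scheme \<Rightarrow> 'w set \<Rightarrow> (sign \<Rightarrow> 'c set) \<Rightarrow> ('c \<Rightarrow> 'c \<Rightarrow> 'w) \<Rightarrow> 'c set \<Rightarrow> bool" where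
  "spherical_residue W S \<Delta> \<delta> R \<longleftrightarrow>
     (\<exists>\<epsilon> J. J \<subseteq> S \<and> finite (generate W J) \<and> residue_of_type W \<Delta> \<delta> \<epsilon> J R)"

definition opposite ::
  "('w, 'm) monoid_scheme \<Rightarrow> (sign \<Rightarrow> 'c set) \<Rightarrow> ('c \<Rightarrow> 'c \<Rightarrow> 'w) \<Rightarrow> 'c \<Rightarrow> 'c \<Rightarrow> bool" where
  "opposite W \<Delta> \<delta>s C D \<longleftrightarrow> (\<exists>\<epsilon>. C \<in> \<Delta> \<epsilon> \<and> D \<in> \<Delta> (opp_sign \<epsilon>) \<and> \<delta>s C D = \<one>\<^bsub>W\<^esub>)"

definition opposite_residues ::
  "('w, 'm) monoid_scheme \<Rightarrow> 'w set \<Rightarrow> (sign \<Rightarrow> 'c set) \<Rightarrow> ('c \<Rightarrow> 'c \<Rightarrow> 'w) \<Rightarrow> ('c \<Rightarrow> 'c \<Rightarrow> 'w) \<Rightarrow>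
   'c set \<Rightarrow> 'c set \<Rightarrow> bool" where
  "opposite_residues W S \<Delta> \<delta> \<delta>s P Q \<longleftrightarrow>
     (\<exists>\<epsilon>. residue_in W S \<Delta> \<delta> \<epsilon> P \<and> residue_in W S \<Delta> \<delta> (opp_sign \<epsilon>) Q) \<and>
     (\<forall>C \<in> P. \<exists>D \<in> Q. opposite W \<Delta> \<delta>s C D)"

definition thick ::
  "('w, 'm) monoid_scheme \<Rightarrow> 'w set \<Rightarrow> (sign \<Rightarrow> 'c set) \<Rightarrow> ('c \<Rightarrow> 'c \<Rightarrow> 'w) \<Rightarrow> bool" where
  "thick W S \<Delta> \<delta> \<longleftrightarrow>
     (\<forall>\<epsilon> s P. s \<in> S \<longrightarrow> residue_of_type W \<Delta> \<delta> \<epsilon> {s} P \<longrightarrow> infinite P \<or> card P \<ge> 3)"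

definition twin_automorphism ::
  "('w, 'm) monoid_scheme \<Rightarrow> 'w set \<Rightarrow> (sign \<Rightarrow> 'c set) \<Rightarrow> ('c \<Rightarrow> 'c \<Rightarrow> 'w) \<Rightarrow> ('c \<Rightarrow> 'c \<Rightarrow> 'w) \<Rightarrow>
   ('c \<Rightarrow> 'c) \<Rightarrow> bool" where
  "twin_automorphism W S \<Delta> \<delta> \<delta>s \<theta> \<longleftrightarrow>
     bij_betw \<theta> (\<Union>\<epsilon>. \<Delta> \<epsilon>) (\<Union>\<epsilon>. \<Delta> \<epsilon>) \<and>
     (\<forall>C \<in> (\<Union>\<epsilon>. \<Delta> \<epsilon>). \<forall>D \<in> (\<Union>\<epsilon>. \<Delta> \<epsilon>).
        (adjacent S \<Delta> \<delta> C D \<longrightarrow> adjacent S \<Delta> \<delta> (\<theta> C) (\<theta> D)) \<and>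
        (opposite W \<Delta> \<delta>s C D \<longleftrightarrow> opposite W \<Delta> \<delta>s (\<theta> C) (\<theta> D)))"

end

theory Submission
  imports Defs
begin

text \<open>
  Choose a chamber \<open>C\<close> for which \<open>w = \<delta>s C (\<theta> C)\<close> has minimal length. Opposition detects panels and their
  types, so \<open>\<theta>\<close> maps \<open>s\<close>-panels onto \<open>\<sigma> s\<close>-panels for a permutation \<open>\<sigma>\<close> of \<open>S\<close>. Comparing \<open>C\<close> with the
  other chambers of its \<open>s\<close>-panel, of which there are at least two, minimality forces \<open>\<sigma> s w = w s\<close>
  whenever \<open>s\<close> is a right descent or \<open>\<sigma> s\<close> a left descent of \<open>w\<close>. Let \<open>K\<close> and \<open>J = \<sigma> K\<close> be the sets of
  right and left descents. A minimal representative of the coset \<open>W\<^sub>J w\<close> can have no right descent, so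
  \<open>w \<in> W\<^sub>J\<close>, and similarly \<open>w \<in> W\<^sub>K\<close>; hence \<open>W\<^sub>J = W\<^sub>K\<close>, which is finite because \<open>J\<close> consists of descents
  of \<open>w\<close>. The \<open>K\<close>-residue of \<open>C\<close> is then opposite its image, the \<open>J\<close>-residue of \<open>\<theta> C\<close>.
\<close>

section \<open>Coxeter systems\<close>

text \<open>
  The number of \<open>i\<close> with \<open>t = s\<^sub>1 \<dots> s\<^sub>i \<dots> s\<^sub>1\<close> for the word \<open>s\<^sub>1 \<dots> s\<^sub>k\<close>. Its parity depends only on the
  product of the word, which yields the exchange condition from the presentation.
\<close>

primrec reflection_count :: "('w, 'm) monoid_scheme \<Rightarrow> 'w list \<Rightarrow> 'w \<Rightarrow> nat" where
  "reflection_count W [] t = 0"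
| "reflection_count W (s # ws) t = (if t = s then 1 else 0) + reflection_count W ws (s \<otimes>\<^bsub>W\<^esub> t \<otimes>\<^bsub>W\<^esub> s)"

context coxeter_system
begin

section \<open>Words over \<open>S\<close>, their products and the length function\<close>

abbreviation wp :: "'w list \<Rightarrow> 'w" where "wp \<equiv> word_prod W"
abbreviation len :: "'w \<Rightarrow> nat" where "len \<equiv> cox_length W S"

lemma wp_Nil [simp]: "wp [] = \<one>"
  by (simp add: word_prod_def)

lemma wp_Cons [simp]: "wp (x # xs) = x \<otimes> wp xs"
  by (simp add: word_prod_def)

lemma S_closed [simp, intro]: "s \<in> S \<Longrightarrow> s \<in> carrier W"
  using S_subset by blast

lemma wp_closed [simp, intro]: "set ws \<subseteq> carrier W \<Longrightarrow> wp ws \<in> carrier W"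
  by (induction ws) auto

lemma wp_closed_S [simp, intro]: "set ws \<subseteq> S \<Longrightarrow> wp ws \<in> carrier W"
  using S_subset by (intro wp_closed) auto

lemma wp_append:
  "set us \<subseteq> carrier W \<Longrightarrow> set vs \<subseteq> carrier W \<Longrightarrow> wp (us @ vs) = wp us \<otimes> wp vs"
  by (induction us) (auto simp: m_assoc)

lemma wp_append_S: "set us \<subseteq> S \<Longrightarrow> set vs \<subseteq> S \<Longrightarrow> wp (us @ vs) = wp us \<otimes> wp vs"
  using S_subset by (intro wp_append) auto

lemma S_sq [simp]: "s \<in> S \<Longrightarrow> s \<otimes> s = \<one>"
  using pow_ord_eq_1[of s] S_order_two[of s] by (simp add: numeral_2_eq_2)

lemma S_inv [simp]: "s \<in> S \<Longrightarrow> inv s = s"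
  by (intro inv_equality) auto

lemma S_not_one: "s \<in> S \<Longrightarrow> s \<noteq> \<one>"
  using S_order_two ord_eq_1 by fastforce

lemma S_cancel_left [simp]: "s \<in> S \<Longrightarrow> x \<in> carrier W \<Longrightarrow> s \<otimes> (s \<otimes> x) = x"
  by (simp flip: m_assoc)

lemma S_cancel_right [simp]: "s \<in> S \<Longrightarrow> x \<in> carrier W \<Longrightarrow> x \<otimes> s \<otimes> s = x"
  by (simp add: m_assoc)

lemma wp_rev: "set ws \<subseteq> S \<Longrightarrow> wp (rev ws) = inv (wp ws)"
  by (induction ws) (auto simp: wp_append_S inv_mult_group)

text \<open>Generators are their own inverses, so words without formal inverses already fill the
  subgroup. This permits induction on words in parabolic subgroups.\<close>

lemma generate_eq_words:
  assumes "J \<subseteq> S" shows "generate W J = wp ` {ws. set ws \<subseteq> J}"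
proof
  show "generate W J \<subseteq> wp ` {ws. set ws \<subseteq> J}"
  proof
    fix x assume "x \<in> generate W J"
    then show "x \<in> wp ` {ws. set ws \<subseteq> J}"
    proof induction
      case one
      show ?case by (rule image_eqI[of _ _ "[]"]) auto
    next
      case (incl h)
      with assms show ?case by (intro image_eqI[of _ _ "[h]"]) auto
    next
      case (inv h)
      with assms have "inv h = h" by auto
      with inv assms show ?case by (intro image_eqI[of _ _ "[h]"]) auto
    next
      case (eng h1 h2)
      then obtain u v where "set u \<subseteq> J" "set v \<subseteq> J" "h1 = wp u" "h2 = wp v" by auto
      moreover from this assms have "wp (u @ v) = wp u \<otimes> wp v"
        by (intro wp_append_S) auto
      ultimately show ?case by (intro image_eqI[of _ _ "u @ v"]) auto
    qed
  qed
  show "wp ` {ws. set ws \<subseteq> J} \<subseteq> generate W J"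
  proof
    fix x assume "x \<in> wp ` {ws. set ws \<subseteq> J}"
    then obtain u where "set u \<subseteq> J" "x = wp u" by auto
    then show "x \<in> generate W J"
      by (induction u arbitrary: x) (auto intro: generate.intros)
  qed
qed

lemma word_exists: "w \<in> carrier W \<Longrightarrow> \<exists>ws. set ws \<subseteq> S \<and> wp ws = w"
  using generate_eq_words[of S] S_generates by auto

lemma reduced_word_exists:
  assumes "w \<in> carrier W" shows "\<exists>ws. set ws \<subseteq> S \<and> length ws = len w \<and> wp ws = w"
proof -
  obtain us where "set us \<subseteq> S" "wp us = w" using word_exists[OF assms] by blast
  then have "\<exists>ws \<in> lists S. length ws = length us \<and> wp ws = w" by auto
  then have "\<exists>ws \<in> lists S. length ws = len w \<and> wp ws = w"
    unfolding cox_length_def by (rule LeastI)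
  then show ?thesis by auto
qed

lemma len_le: "set ws \<subseteq> S \<Longrightarrow> len (wp ws) \<le> length ws"
  unfolding cox_length_def by (rule Least_le) auto

lemma len_one [simp]: "len \<one> = 0"
  using len_le[of "[]"] by simp

lemma len_0_iff: "w \<in> carrier W \<Longrightarrow> len w = 0 \<longleftrightarrow> w = \<one>"
  using reduced_word_exists[of w] by auto

lemma len_inv: assumes "w \<in> carrier W" shows "len (inv w) = len w"
proof -
  have le: "len (inv v) \<le> len v" if v: "v \<in> carrier W" for v
  proof -
    obtain ws where "set ws \<subseteq> S" "length ws = len v" "wp ws = v"
      using reduced_word_exists[OF v] by blast
    then show ?thesis using len_le[of "rev ws"] by (auto simp: wp_rev)
  qed
  show ?thesis using le[of w] le[of "inv w"] assms by simp
qed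

section \<open>Parity of reflection counts and the exchange condition\<close>

lemma reflection_count_append:
  assumes "set u \<subseteq> S" "set v \<subseteq> S" "t \<in> carrier W"
  shows "reflection_count W (u @ v) t = reflection_count W u t + reflection_count W v (inv (wp u) \<otimes> t \<otimes> wp u)"
  using assms
proof (induction u arbitrary: t)
  case Nil
  then show ?case by simp
next
  case (Cons s u)
  then have "s \<in> S" "set u \<subseteq> S" by auto
  then show ?case using Cons by (simp add: inv_mult_group m_assoc)
qed

lemma wp_alternating:
  "s \<in> S \<Longrightarrow> t \<in> S \<Longrightarrow> wp (concat (replicate k [s, t])) = (s \<otimes> t) [^] k"
proof (induction k)
  case (Suc k)
  then show ?case using nat_pow_Suc2[of "s \<otimes> t" k] by (simp add: m_assoc del: nat_pow_Suc)
qed simp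

text \<open>The prefix reflections \<open>s\<close>, \<open>sts\<close>, \<open>ststs\<close>, ...
  of the alternating word are the elements \<open>(st)^i s\<close>. Writing the count as a sum over
  \<open>i\<close> exposes their periodicity.\<close>

lemma reflection_count_alternating:
  assumes "s \<in> S" "t \<in> S" "r \<in> carrier W"
  shows "reflection_count W (concat (replicate k [s, t])) r
       = (\<Sum>i<2*k. if r = (s \<otimes> t) [^] i \<otimes> s then 1 else 0)"
  using assms(3)
proof (induction k arbitrary: r)
  case 0
  then show ?case by simp
next
  case (Suc k)
  note r = Suc.prems
  \<comment> \<open>\<open>q\<close> is what \<open>r\<close> has become after two letters are read.
    Fact \<open>1\<close> identifies the test at the second letter as exponent one; fact
    \<open>2\<close> shifts the tests on \<open>q\<close> by two exponents.\<close>
  define q where "q = t \<otimes> (s \<otimes> r \<otimes> s) \<otimes> t"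
  have q: "q \<in> carrier W" unfolding q_def using assms r by auto
  have 1: "s \<otimes> r \<otimes> s = t \<longleftrightarrow> r = (s \<otimes> t) [^] (1::nat) \<otimes> s"
  proof
    assume "s \<otimes> r \<otimes> s = t"
    then have "s \<otimes> (s \<otimes> r \<otimes> s) \<otimes> s = s \<otimes> t \<otimes> s" by simp
    then show "r = (s \<otimes> t) [^] (1::nat) \<otimes> s" using assms r by (simp add: m_assoc)
  qed (use assms r in \<open>simp add: m_assoc\<close>)
  have 2: "q = (s \<otimes> t) [^] i \<otimes> s \<longleftrightarrow> r = (s \<otimes> t) [^] (i + 2) \<otimes> s" for i :: nat
  proof -
    have r_q: "r = s \<otimes> t \<otimes> q \<otimes> t \<otimes> s" unfolding q_def using assms r by (simp add: m_assoc)
    have p: "(s \<otimes> t) [^] (i + 2) = s \<otimes> t \<otimes> (s \<otimes> t) [^] i \<otimes> (s \<otimes> t)"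
      using assms nat_pow_Suc2[of "s \<otimes> t" i] by (simp add: m_assoc)
    show ?thesis
    proof
      assume "q = (s \<otimes> t) [^] i \<otimes> s"
      then show "r = (s \<otimes> t) [^] (i + 2) \<otimes> s" unfolding r_q p using assms by (simp add: m_assoc)
    next
      assume a: "r = (s \<otimes> t) [^] (i + 2) \<otimes> s"
      show "q = (s \<otimes> t) [^] i \<otimes> s" unfolding q_def a p using assms by (simp add: m_assoc)
    qed
  qed
  have "reflection_count W (concat (replicate (Suc k) [s, t])) r
      = (if r = s then 1 else 0) + (if s \<otimes> r \<otimes> s = t then 1 else 0)
        + (\<Sum>i<2*k. if q = (s \<otimes> t) [^] i \<otimes> s then 1 else 0)"
    using Suc.IH[OF q] by (auto simp: q_def)
  also have "\<dots> = (\<Sum>i<Suc (Suc (2*k)). if r = (s \<otimes> t) [^] i \<otimes> s then 1 else 0)"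
    unfolding sum.lessThan_Suc_shift 2 1 using assms by simp
  finally show ?case by simp
qed

text \<open>The \<open>2 * m\<close> summands have period \<open>m\<close>, so each value is added
  twice. For infinite order \<open>m = 0\<close>, and the word and the sum are empty.\<close>

lemma even_reflection_count_relator:
  assumes "s \<in> S" "t \<in> S" "r \<in> carrier W"
  shows "even (reflection_count W (concat (replicate (ord (s \<otimes> t)) [s, t])) r)"
proof -
  define m where "m = ord (s \<otimes> t)"
  define f where "f i = (if r = (s \<otimes> t) [^] i \<otimes> s then 1 else 0 :: nat)" for i :: nat
  have period: "f (i + m) = f i" for i
    unfolding f_def m_def using assms by (simp flip: nat_pow_mult)
  have "(\<Sum>i<2*m. f i) = (\<Sum>i<m. f i) + (\<Sum>i=m..<m+m. f i)"
    by (simp add: lessThan_atLeast0 sum.atLeastLessThan_concat mult_2)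
  also have "(\<Sum>i=m..<m+m. f i) = (\<Sum>i<m. f i)"
    using sum.shift_bounds_nat_ivl[of f 0 m m] period by (simp add: lessThan_atLeast0)
  finally show ?thesis
    unfolding reflection_count_alternating[OF assms] m_def[symmetric] f_def by simp
qed

text \<open>A relator has product \<open>\<one>\<close>, so the word behind it is tested on the same
  element whether or not the relator is present, and the relator itself contributes an even
  number.\<close>

lemma coxeter_cong_reflection_count:
  assumes "coxeter_cong W S u v"
  shows "set u \<subseteq> S \<and> set v \<subseteq> S \<and> wp u = wp v \<and>
    (\<forall>t \<in> carrier W. even (reflection_count W u t) = even (reflection_count W v t))"
  using assms
proof induction
  case (relator u v s t)
  then have uv: "set u \<subseteq> S" "set v \<subseteq> S" and st: "s \<in> S" "t \<in> S" by auto
  let ?r = "concat (replicate (ord (s \<otimes> t)) [s, t])"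
  have r: "set ?r \<subseteq> S" using uv st by (auto simp: set_replicate_conv_if split: if_splits)
  have wr: "wp ?r = \<one>" using uv st by (simp add: wp_alternating)
  have rv: "set (?r @ v) \<subseteq> S" using r uv by (auto simp del: set_concat)
  have w: "wp (?r @ v) = wp v" using wp_append_S[OF r uv(2)] wr uv by simp
  have "even (reflection_count W (u @ ?r @ v) x) = even (reflection_count W (u @ v) x)" if x: "x \<in> carrier W" for x
  proof -
    let ?y = "inv (wp u) \<otimes> x \<otimes> wp u"
    have y: "?y \<in> carrier W" using uv st x by simp
    have "reflection_count W (u @ ?r @ v) x = reflection_count W u x + reflection_count W (?r @ v) ?y"
      using reflection_count_append[OF uv(1) rv x] .
    moreover have "reflection_count W (?r @ v) ?y = reflection_count W ?r ?y + reflection_count W v ?y"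
      using reflection_count_append[OF r uv(2) y] wr y by simp
    moreover have "reflection_count W (u @ v) x = reflection_count W u x + reflection_count W v ?y"
      using reflection_count_append[OF uv x] .
    ultimately show ?thesis using even_reflection_count_relator[OF st y] by simp
  qed
  moreover have "wp (u @ ?r @ v) = wp (u @ v)"
    using wp_append_S[OF uv(1) rv] wp_append_S[OF uv] w by simp
  moreover have "set (u @ ?r @ v) \<subseteq> S" "set (u @ v) \<subseteq> S" using uv r by (auto simp del: set_concat)
  ultimately show ?case by blast
qed auto

text \<open>A counted \<open>t\<close> is some letter \<open>x\<close> conjugated by the product of
  the letters before it; multiplying by \<open>t\<close> therefore cancels exactly this
  \<open>x\<close>.\<close>

lemma reflection_count_deletion:
  assumes "set ws \<subseteq> S" "t \<in> carrier W" "reflection_count W ws t \<noteq> 0"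
  shows "\<exists>a x b. ws = a @ x # b \<and> t \<otimes> wp ws = wp (a @ b)"
  using assms
proof (induction ws arbitrary: t)
  case (Cons s ws)
  show ?case
  proof (cases "t = s")
    case True
    then have "s # ws = [] @ s # ws \<and> t \<otimes> wp (s # ws) = wp ([] @ ws)" using Cons by simp
    then show ?thesis by blast
  next
    case False
    with Cons.prems have "set ws \<subseteq> S" "s \<otimes> t \<otimes> s \<in> carrier W" "reflection_count W ws (s \<otimes> t \<otimes> s) \<noteq> 0"
      by auto
    then obtain a x b where ab: "ws = a @ x # b" "s \<otimes> t \<otimes> s \<otimes> wp ws = wp (a @ b)"
      using Cons.IH by blast
    have "s \<otimes> (s \<otimes> t \<otimes> s \<otimes> wp ws) = t \<otimes> (s \<otimes> wp ws)"
      using Cons.prems by (auto simp: m_assoc)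
    then have "s # ws = (s # a) @ x # b \<and> t \<otimes> wp (s # ws) = wp ((s # a) @ b)" using ab by simp
    then show ?thesis by blast
  qed
qed simp

text \<open>The parity of the count at \<open>s\<close> decides the direction. If it is odd, a
  letter can be deleted from \<open>ws\<close> and also from a reduced word of the same element. If
  it is even, the count is odd for \<open>s # ws\<close>, so the same argument shows that removing
  \<open>s\<close> again shortens.\<close>

lemma exchange_dichotomy:
  assumes s: "s \<in> S" and ws: "set ws \<subseteq> S"
  shows "len (s \<otimes> wp ws) < len (wp ws) \<and> (\<exists>a x b. ws = a @ x # b \<and> s \<otimes> wp ws = wp (a @ b))
    \<or> len (wp ws) < len (s \<otimes> wp ws)"
proof -
  have short: "len (s \<otimes> wp us) < len (wp us)" if us: "set us \<subseteq> S" and o: "odd (reflection_count W us s)" for us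
  proof -
    obtain rs where rs: "set rs \<subseteq> S" "length rs = len (wp us)" "wp rs = wp us"
      using reduced_word_exists us by blast
    \<comment> \<open>By the presentation \<open>rs\<close> and \<open>us\<close> are congruent,
      which carries the parity over to a reduced word.\<close>
    then have "odd (reflection_count W rs s)"
      using coxeter_cong_reflection_count[OF presentation[of rs us]] us o s by (auto simp: in_lists_conv_set subset_iff)
    then obtain a x b where "rs = a @ x # b" "s \<otimes> wp rs = wp (a @ b)"
      using reflection_count_deletion[OF rs(1)] s by (metis S_closed even_zero)
    then show ?thesis using rs len_le[of "a @ b"] by auto
  qed
  show ?thesis
  proof (cases "odd (reflection_count W ws s)")
    case True
    then show ?thesis using short[OF ws] reflection_count_deletion[OF ws, of s] s by (metis S_closed even_zero)
  next
    case False
    then have "odd (reflection_count W (s # ws) s)" using s by simp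
    then show ?thesis using short[of "s # ws"] s ws by simp
  qed
qed

lemma exchange:
  assumes "s \<in> S" "set ws \<subseteq> S" "len (s \<otimes> wp ws) \<le> len (wp ws)"
  shows "\<exists>a x b. ws = a @ x # b \<and> s \<otimes> wp ws = wp (a @ b)"
  using exchange_dichotomy[OF assms(1,2)] assms(3) by auto

section \<open>Descents and the change of length under multiplication by generators\<close>

lemma len_S_mult_le:
  assumes "s \<in> S" "w \<in> carrier W" shows "len (s \<otimes> w) \<le> len w + 1"
proof -
  obtain ws where "set ws \<subseteq> S" "length ws = len w" "wp ws = w"
    using reduced_word_exists assms by blast
  then show ?thesis using len_le[of "s # ws"] assms by simp
qed

lemma len_left_cases:
  assumes "s \<in> S" "w \<in> carrier W"
  obtains "len (s \<otimes> w) = len w + 1" | "len (s \<otimes> w) + 1 = len w"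
proof -
  have "len (s \<otimes> w) \<noteq> len w"
    using exchange_dichotomy[OF assms(1)] word_exists[OF assms(2)] by force
  moreover have "len w \<le> len (s \<otimes> w) + 1"
    using len_S_mult_le[of s "s \<otimes> w"] assms by simp
  ultimately show ?thesis using len_S_mult_le[OF assms] that by linarith
qed

lemma len_mult_right:
  assumes "s \<in> S" "w \<in> carrier W" shows "len (w \<otimes> s) = len (s \<otimes> inv w)"
  using len_inv[of "w \<otimes> s"] assms by (simp add: inv_mult_group)

lemma len_right_cases:
  assumes "s \<in> S" "w \<in> carrier W"
  obtains "len (w \<otimes> s) = len w + 1" | "len (w \<otimes> s) + 1 = len w"
  using len_left_cases[of s "inv w"] assms that by (metis inv_closed len_inv len_mult_right)

lemma len_S: "s \<in> S \<Longrightarrow> len s = 1"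
  using len_left_cases[of s \<one>] by auto

lemma left_descent_exists:
  assumes "w \<in> carrier W" "w \<noteq> \<one>"
  shows "\<exists>s \<in> S. len (s \<otimes> w) + 1 = len w"
proof -
  obtain ws where ws: "set ws \<subseteq> S" "length ws = len w" "wp ws = w"
    using reduced_word_exists assms by blast
  then obtain s us where "ws = s # us" using assms by (cases ws) auto
  with ws have s: "s \<in> S" and us: "set us \<subseteq> S" "w = s \<otimes> wp us" by auto
  then have "len (s \<otimes> w) \<le> length us" using len_le[of us] by simp
  then have "len (s \<otimes> w) < len w" using ws(2) \<open>ws = s # us\<close> by auto
  then show ?thesis using s len_left_cases[OF s assms(1)] by (metis add_lessD1 less_irrefl)
qed

lemma right_descent_exists:
  assumes "w \<in> carrier W" "w \<noteq> \<one>"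
  shows "\<exists>s \<in> S. len (w \<otimes> s) + 1 = len w"
  using left_descent_exists[of "inv w"] assms by (auto simp: len_mult_right len_inv)

text \<open>If the second multiplication did not lengthen, exchange would delete a letter from a
  word for \<open>v \<otimes> s\<close>. Deleting the final \<open>s\<close> gives
  \<open>t \<otimes> v = v \<otimes> s\<close>; deleting a letter of \<open>v\<close> makes
  \<open>t \<otimes> v\<close> too short.\<close>

lemma lift_both_sides:
  assumes "s \<in> S" "t \<in> S" "v \<in> carrier W"
    and "len (t \<otimes> v) = len v + 1" "len (v \<otimes> s) = len v + 1" "t \<otimes> v \<noteq> v \<otimes> s"
  shows "len (t \<otimes> v \<otimes> s) = len v + 2"
proof -
  obtain vs where vs: "set vs \<subseteq> S" "length vs = len v" "wp vs = v"
    using reduced_word_exists assms by blast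
  have wvs: "wp (vs @ [s]) = v \<otimes> s" using wp_append_S[OF vs(1)] assms vs by simp
  have "\<not> len (t \<otimes> (v \<otimes> s)) \<le> len (v \<otimes> s)"
  proof
    assume "len (t \<otimes> (v \<otimes> s)) \<le> len (v \<otimes> s)"
    then obtain a x b where ab: "vs @ [s] = a @ x # b" "t \<otimes> (v \<otimes> s) = wp (a @ b)"
      using exchange[OF assms(2), of "vs @ [s]"] vs assms unfolding wvs by auto
    show False
    proof (cases b rule: rev_cases)
      case Nil
      then have "t \<otimes> (v \<otimes> s) = v" using ab vs by simp
      then have "t \<otimes> (v \<otimes> s) \<otimes> s = v \<otimes> s" by simp
      then show False using assms by (simp add: m_assoc)
    next
      case (snoc c y)
      then have vs': "vs = a @ x # c" "y = s" using ab by auto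
      then have ac: "set (a @ c) \<subseteq> S" using vs(1) by auto
      have "t \<otimes> (v \<otimes> s) = wp (a @ c) \<otimes> s"
        using ab(2) snoc vs' wp_append_S[OF ac, of "[s]"] assms by simp
      then have "t \<otimes> v \<otimes> s = wp (a @ c) \<otimes> s" using assms by (simp add: m_assoc)
      then have "t \<otimes> v = wp (a @ c)" using assms ac by (subst (asm) right_cancel) auto
      then show False using len_le[OF ac] vs vs' assms by simp
    qed
  qed
  then show ?thesis using len_left_cases[of t "v \<otimes> s"] assms by (auto simp: m_assoc)
qed

section \<open>The deletion condition and parabolic subgroups\<close>

lemma deletion:
  assumes "set ws \<subseteq> S" "len (wp ws) < length ws"
  shows "\<exists>a x b y c. ws = a @ x # b @ y # c \<and> wp ws = wp (a @ b @ c)"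
  using assms
proof (induction ws)
  case (Cons s ws)
  then have s: "s \<in> S" and ws: "set ws \<subseteq> S" by auto
  show ?case
  proof (cases "len (wp ws) < length ws")
    case True
    then obtain a x b y c where "ws = a @ x # b @ y # c" "wp ws = wp (a @ b @ c)"
      using Cons.IH[OF ws] by blast
    then have "s # ws = (s # a) @ x # b @ y # c \<and> wp (s # ws) = wp ((s # a) @ b @ c)" by simp
    then show ?thesis by blast
  next
    case False
    \<comment> \<open>Here \<open>ws\<close> is reduced but \<open>s # ws\<close> is not, so
      exchange cancels \<open>s\<close> against a letter of \<open>ws\<close>.\<close>
    then have "len (s \<otimes> wp ws) \<le> len (wp ws)" using Cons.prems len_le[OF ws] by simp
    then obtain a x b where "ws = a @ x # b" "s \<otimes> wp ws = wp (a @ b)"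
      using exchange[OF s ws] by blast
    then have "s # ws = [] @ s # a @ x # b \<and> wp (s # ws) = wp ([] @ a @ b)" by simp
    then show ?thesis by blast
  qed
qed simp

text \<open>A shortest \<open>J\<close>-word is reduced with respect to all of \<open>S\<close>,
  because deletion only removes letters and so never leaves \<open>J\<close>.\<close>

lemma reduced_J_word_exists:
  assumes J: "J \<subseteq> S" and x: "x \<in> generate W J"
  shows "\<exists>ws. set ws \<subseteq> J \<and> length ws = len x \<and> wp ws = x"
proof -
  obtain k where "set k \<subseteq> J \<and> wp k = x" using x generate_eq_words[OF J] by auto
  then obtain ws where ws: "set ws \<subseteq> J" "wp ws = x"
    and min: "\<And>us. set us \<subseteq> J \<Longrightarrow> wp us = x \<Longrightarrow> length ws \<le> length us"
    using ex_has_least_nat[of "\<lambda>ws. set ws \<subseteq> J \<and> wp ws = x" k length] by blast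
  have wsS: "set ws \<subseteq> S" using ws J by auto
  have "\<not> len x < length ws"
  proof
    assume "len x < length ws"
    then obtain a y b z c where "ws = a @ y # b @ z # c" "wp ws = wp (a @ b @ c)"
      using deletion[OF wsS] ws by auto
    then show False using ws min[of "a @ b @ c"] by auto
  qed
  then show ?thesis using ws len_le[OF wsS] by (intro exI[of _ ws]) auto
qed

text \<open>When \<open>s\<close> is put in front of a prefix \<open>us\<close> of \<open>w\<close>,
  exchange removes a letter of \<open>us @ zs\<close>. It cannot belong to \<open>us\<close>, since
  \<open>s # us\<close> is reduced, so it belongs to \<open>zs\<close>, and \<open>s # us\<close>
  becomes the prefix.\<close>

lemma prefix_of_descents:
  assumes w: "w \<in> carrier W" and desc: "\<And>s. s \<in> J \<Longrightarrow> len (s \<otimes> w) < len w" and J: "J \<subseteq> S"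
    and us: "set us \<subseteq> J" "len (wp us) = length us"
  shows "\<exists>zs. set zs \<subseteq> S \<and> wp us \<otimes> wp zs = w \<and> length us + length zs = len w"
  using us
proof (induction us)
  case Nil
  then show ?case using reduced_word_exists[OF w] by auto
next
  case (Cons s us)
  then have s: "s \<in> J" "s \<in> S" and us: "set us \<subseteq> J" "set us \<subseteq> S" using J by auto
  have "len (wp us) = length us"
    using Cons.prems len_S_mult_le[OF s(2), of "wp us"] len_le us by fastforce
  then obtain zs where zs: "set zs \<subseteq> S" "wp us \<otimes> wp zs = w" "length us + length zs = len w"
    using Cons.IH us by blast
  have wuz: "wp (us @ zs) = w" using wp_append_S us zs by simp
  then obtain a x b where ab: "us @ zs = a @ x # b" "s \<otimes> w = wp (a @ b)"
    using exchange[OF s(2), of "us @ zs"] desc[OF s(1)] us zs by auto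
  consider c where "us = a @ x # c" "b = c @ zs" | c where "a = us @ c" "zs = c @ x # b"
    using ab(1) by (auto simp: append_eq_append_conv2 append_eq_Cons_conv Cons_eq_append_conv)
  then show ?case
  proof cases
    case 1
    have ac: "set (a @ c) \<subseteq> S" using 1 us by auto
    have "s \<otimes> wp us \<otimes> wp zs = wp (a @ c) \<otimes> wp zs"
      using ab(2) zs us s 1 wp_append_S[OF ac zs(1)] by (simp add: m_assoc flip: zs(2))
    then have "s \<otimes> wp us = wp (a @ c)"
      using s us ac zs by (subst (asm) right_cancel) auto
    then have "len (wp (s # us)) \<le> length us" using len_le[OF ac] 1 by simp
    then show ?thesis using Cons.prems by simp
  next
    case 2
    have cb: "set (c @ b) \<subseteq> S" using 2 zs by auto
    have "s \<otimes> w = wp us \<otimes> wp (c @ b)"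
      using ab(2) 2 wp_append_S[OF us(2) cb] by simp
    then have "s \<otimes> (s \<otimes> w) = s \<otimes> (wp us \<otimes> wp (c @ b))" by simp
    then have "w = wp (s # us) \<otimes> wp (c @ b)"
      using s w us cb by (simp add: m_assoc)
    then show ?thesis using cb zs 2 by (intro exI[of _ "c @ b"]) auto
  qed
qed

text \<open>Reduced words of elements of the parabolic subgroup are prefixes of reduced words of
  \<open>w\<close>, hence bounded in length over a finite alphabet.\<close>

lemma finite_parabolic_of_descents:
  assumes "finite S" "w \<in> carrier W" "\<And>s. s \<in> J \<Longrightarrow> len (s \<otimes> w) < len w" "J \<subseteq> S"
  shows "finite (generate W J)"
proof (rule finite_subset)
  show "generate W J \<subseteq> wp ` {us. set us \<subseteq> S \<and> length us \<le> len w}"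
  proof
    fix x assume "x \<in> generate W J"
    then obtain us where us: "set us \<subseteq> J" "length us = len x" "wp us = x"
      using reduced_J_word_exists assms by blast
    then have "length us \<le> len w" using prefix_of_descents[OF assms(2-4) us(1)] by auto
    then show "x \<in> wp ` {us. set us \<subseteq> S \<and> length us \<le> len w}"
      using us assms(4) by (intro image_eqI[of _ _ us]) auto
  qed
  show "finite (wp ` {us. set us \<subseteq> S \<and> length us \<le> len w})"
    using assms(1) by (intro finite_imageI finite_lists_length_le)
qed

lemma parabolic_subgroup: "J \<subseteq> S \<Longrightarrow> subgroup (generate W J) W"
  using S_subset by (intro generate_is_subgroup) auto

text \<open>\<open>u\<close> is a shortest element of the coset of \<open>w\<close>. Lengths add
  because a deletion in the joined word would shorten either \<open>x\<close> or the coset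
  representative.\<close>

lemma parabolic_factorization:
  assumes J: "J \<subseteq> S" and w: "w \<in> carrier W"
  obtains x u where "x \<in> generate W J" "u \<in> carrier W" "w = x \<otimes> u" "len w = len x + len u"
    "\<And>y. y \<in> generate W J \<Longrightarrow> len u \<le> len (y \<otimes> u)"
proof -
  interpret P: subgroup "generate W J" W by (rule parabolic_subgroup[OF J])
  have "w \<in> carrier W \<and> (\<exists>x \<in> generate W J. w = x \<otimes> w)"
    using w generate.one by force
  then obtain u x where u: "u \<in> carrier W" and x: "x \<in> generate W J" and wxu: "w = x \<otimes> u"
    and min: "\<And>v y. v \<in> carrier W \<Longrightarrow> y \<in> generate W J \<Longrightarrow> w = y \<otimes> v \<Longrightarrow> len u \<le> len v"
    using ex_has_least_nat[of "\<lambda>u. u \<in> carrier W \<and> (\<exists>x \<in> generate W J. w = x \<otimes> u)" w len] by blast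
  obtain ps where ps: "set ps \<subseteq> J" "length ps = len x" "wp ps = x"
    using reduced_J_word_exists[OF J x] by blast
  obtain us where us: "set us \<subseteq> S" "length us = len u" "wp us = u"
    using reduced_word_exists[OF u] by blast
  have psS: "set ps \<subseteq> S" using ps J by auto
  have pu: "set (ps @ us) \<subseteq> S" "wp (ps @ us) = w" using psS us wxu ps by (auto simp: wp_append_S)
  have "\<not> len w < length (ps @ us)"
  proof
    assume "len w < length (ps @ us)"
    then obtain a y b z c where d: "ps @ us = a @ y # b @ z # c" "w = wp (a @ b @ c)"
      using deletion[OF pu(1)] pu(2) by auto
    \<comment> \<open>A \<open>J\<close>-word followed by fewer than \<open>len u\<close> letters
      would exhibit a shorter element of the coset.\<close>
    have no_u: False if "set p \<subseteq> J" "set q \<subseteq> S" "w = wp p \<otimes> wp q" "length q < len u" for p q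
    proof -
      have "wp p \<in> generate W J" using that generate_eq_words[OF J] by blast
      then show False using min[of "wp q" "wp p"] that len_le[of q] by auto
    qed
    \<comment> \<open>The two deleted letters lie both in \<open>ps\<close>, one in each part, or
      both in \<open>us\<close>.\<close>
    consider e where "ps = a @ y # b @ z # e" "c = e @ us"
      | e f where "b = e @ f" "ps = a @ y # e" "us = f @ z # c"
      | e where "a = ps @ e" "us = e @ y # b @ z # c"
    proof -
      from d(1) consider f where "ps = a @ f" "f @ us = y # b @ z # c"
        | e where "a = ps @ e" "us = e @ y # b @ z # c"
        by (auto simp: append_eq_append_conv2)
      then show thesis
      proof cases
        case 1
        show thesis
        proof (cases f)
          case Nil
          then show thesis using 1 that(3)[of "[]"] by simp
        next
          case (Cons y' f')
          then have f': "ps = a @ y # f'" "f' @ us = b @ z # c" using 1 by auto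
          from f'(2) consider g where "f' = b @ g" "g @ us = z # c"
            | e where "b = f' @ e" "us = e @ z # c"
            by (auto simp: append_eq_append_conv2)
          then show thesis
          proof cases
            case 1
            then show thesis using f' that(1) that(2)[of b "[]"] by (cases g) auto
          next
            case 2
            then show thesis using f' that(2) by blast
          qed
        qed
      qed (use that(3) in blast)
    qed
    then show False
    proof cases
      case (1 e)
      have abe: "set (a @ b @ e) \<subseteq> S" using 1 psS by auto
      then have "w = wp (a @ b @ e) \<otimes> u"
        using d(2) 1 us wp_append_S[OF abe us(1)] by simp
      then have "x = wp (a @ b @ e)"
        using wxu u x abe by (metis P.mem_carrier right_cancel wp_closed_S)
      then show False using len_le[OF abe] ps 1 by simp
    next
      case (2 e f)
      have "w = wp (a @ e) \<otimes> wp (f @ c)"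
        using d(2) 2 psS us wp_append_S[of "a @ e" "f @ c"] by auto
      then show False using no_u[of "a @ e" "f @ c"] 2 ps us by auto
    next
      case (3 e)
      have "w = wp ps \<otimes> wp (e @ b @ c)"
        using d(2) 3 psS us wp_append_S[of ps "e @ b @ c"] by auto
      then show False using no_u[of ps "e @ b @ c"] 3 ps us by auto
    qed
  qed
  then have len: "len w = len x + len u" using len_le[OF pu(1)] pu(2) ps us by simp
  have "len u \<le> len (y \<otimes> u)" if y: "y \<in> generate W J" for y
  proof (rule min)
    show "x \<otimes> inv y \<in> generate W J" using x y by simp
    show "w = x \<otimes> inv y \<otimes> (y \<otimes> u)"
      using wxu x y u by (simp add: m_assoc) (simp flip: m_assoc)
  qed (use y u in auto)
  with that x u wxu len show thesis by blast
qed

lemma len_mult_le: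
  assumes "x \<in> carrier W" "y \<in> carrier W" shows "len (x \<otimes> y) \<le> len x + len y"
proof -
  obtain us vs where "set us \<subseteq> S" "length us = len x" "wp us = x"
    "set vs \<subseteq> S" "length vs = len y" "wp vs = y"
    using reduced_word_exists assms by metis
  then show ?thesis using len_le[of "us @ vs"] by (simp add: wp_append_S)
qed

text \<open>A nontrivial minimal representative \<open>u\<close> would have a right descent
  \<open>t\<close>, which is then a descent of \<open>w\<close> as well. The relation
  \<open>s \<otimes> w = w \<otimes> t\<close> places \<open>u \<otimes> t\<close> in the coset of
  \<open>u\<close>, against minimality.\<close>

lemma mem_parabolic_of_descents:
  assumes w: "w \<in> carrier W" and J: "J \<subseteq> S"
    and conj: "\<And>t. t \<in> S \<Longrightarrow> len (w \<otimes> t) + 1 = len w \<Longrightarrow> \<exists>s \<in> J. s \<otimes> w = w \<otimes> t"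
  shows "w \<in> generate W J"
proof -
  interpret P: subgroup "generate W J" W by (rule parabolic_subgroup[OF J])
  obtain x u where x: "x \<in> generate W J" and u: "u \<in> carrier W" and xu: "w = x \<otimes> u"
    "len w = len x + len u" and min: "\<And>y. y \<in> generate W J \<Longrightarrow> len u \<le> len (y \<otimes> u)"
    using parabolic_factorization[OF J w] by metis
  have xc: "x \<in> carrier W" using x by simp
  have "u = \<one>"
  proof (rule ccontr)
    assume "u \<noteq> \<one>"
    then obtain t where t: "t \<in> S" "len (u \<otimes> t) + 1 = len u" using right_descent_exists[OF u] by blast
    have "len (w \<otimes> t) \<le> len x + len (u \<otimes> t)"
      using len_mult_le[of x "u \<otimes> t"] xu xc u t by (simp add: m_assoc)
    then have "len (w \<otimes> t) + 1 = len w" using t xu(2) by (cases rule: len_right_cases[OF t(1) w]) linarith+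
    then obtain s where s: "s \<in> J" "s \<otimes> w = w \<otimes> t" using conj t by blast
    have sc: "s \<in> carrier W" using s J by auto
    have "inv x \<otimes> s \<otimes> x \<otimes> u = inv x \<otimes> (x \<otimes> u \<otimes> t)"
      using s xu xc sc u t by (simp add: m_assoc)
    also have "\<dots> = u \<otimes> t" using xc u t by (simp add: m_assoc) (simp flip: m_assoc)
    finally have "inv x \<otimes> s \<otimes> x \<otimes> u = u \<otimes> t" .
    moreover have "inv x \<otimes> s \<otimes> x \<in> generate W J" using x generate.incl[OF s(1), of W] by simp
    ultimately show False using min[of "inv x \<otimes> s \<otimes> x"] t by simp
  qed
  then show ?thesis using x xu xc by simp
qed

end

section \<open>Twin buildings\<close>

lemma opp_sign_opp_sign [simp]: "opp_sign (opp_sign \<epsilon>) = \<epsilon>"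
  by (cases \<epsilon>) auto

context twin_building
begin

section \<open>The Weyl distance inside one half\<close>

lemma dist_in [simp]: "C \<in> \<Delta> \<epsilon> \<Longrightarrow> D \<in> \<Delta> \<epsilon> \<Longrightarrow> \<delta> C D \<in> carrier W"
  by (rule building.dist_closed[OF halves])

lemma dist_one_iff: "C \<in> \<Delta> \<epsilon> \<Longrightarrow> D \<in> \<Delta> \<epsilon> \<Longrightarrow> \<delta> C D = \<one> \<longleftrightarrow> C = D"
  by (rule building.WD1[OF halves])

lemma dist_step:
  "B \<in> \<Delta> \<epsilon> \<Longrightarrow> D \<in> \<Delta> \<epsilon> \<Longrightarrow> A \<in> \<Delta> \<epsilon> \<Longrightarrow> s \<in> S \<Longrightarrow> \<delta> A B = s \<Longrightarrow> \<delta> A D \<in> {s \<otimes> \<delta> B D, \<delta> B D}"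
  using building.WD2[OF halves] by blast

lemma dist_up:
  "B \<in> \<Delta> \<epsilon> \<Longrightarrow> D \<in> \<Delta> \<epsilon> \<Longrightarrow> A \<in> \<Delta> \<epsilon> \<Longrightarrow> s \<in> S \<Longrightarrow> \<delta> A B = s \<Longrightarrow>
    len (s \<otimes> \<delta> B D) = len (\<delta> B D) + 1 \<Longrightarrow> \<delta> A D = s \<otimes> \<delta> B D"
  using building.WD2[OF halves] by blast

text \<open>The step rule for the closed gallery from \<open>C\<close> to \<open>D\<close> and back
  to \<open>C\<close> leaves a single possible value.\<close>

lemma dist_sym:
  assumes "C \<in> \<Delta> \<epsilon>" "D \<in> \<Delta> \<epsilon>" "s \<in> S" "\<delta> C D = s"
  shows "\<delta> D C = s"
proof -
  have "\<one> \<in> {s \<otimes> \<delta> D C, \<delta> D C}"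
    using dist_step[OF assms(2,1,1,3,4)] dist_one_iff[OF assms(1,1)] by simp
  moreover have "\<delta> D C \<noteq> \<one>"
    using dist_one_iff[OF assms(1,2)] dist_one_iff[OF assms(2,1)] assms S_not_one by auto
  ultimately have "s \<otimes> \<one> = s \<otimes> (s \<otimes> \<delta> D C)" by auto
  then show ?thesis using assms by simp
qed

lemma dist_move:
  assumes "C \<in> \<Delta> \<epsilon>" "D \<in> \<Delta> \<epsilon>" "s \<in> S"
  obtains B where "B \<in> \<Delta> \<epsilon>" "\<delta> C B = s" "\<delta> B D = s \<otimes> \<delta> C D"
  using building.WD3[OF halves assms] dist_sym assms by blast

lemma panel_trans:
  assumes "C \<in> \<Delta> \<epsilon>" "D \<in> \<Delta> \<epsilon>" "E \<in> \<Delta> \<epsilon>" "s \<in> S" "\<delta> C D = s" "\<delta> C E = s" "D \<noteq> E"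
  shows "\<delta> D E = s"
  using dist_step[OF assms(1,3,2,4)] dist_sym[OF assms(1,2,4,5)] dist_one_iff[OF assms(2,3)] assms
  by auto

text \<open>Crossing panels of two different types produces a distance of length two, which is no
  generator. Through this lemma, preservation of adjacency alone controls panels.\<close>

lemma triangle_type:
  assumes "A \<in> \<Delta> \<epsilon>" "B \<in> \<Delta> \<epsilon>" "E \<in> \<Delta> \<epsilon>"
    and "\<delta> A B \<in> S" "\<delta> B E \<in> S" "\<delta> A E \<in> S"
  shows "\<delta> A B = \<delta> B E"
proof (rule ccontr)
  let ?s = "\<delta> A B" and ?t = "\<delta> B E"
  assume neq: "?s \<noteq> ?t"
  have "len (?s \<otimes> ?t) = len ?t + 1"
  proof (cases rule: len_left_cases[OF assms(4) S_closed[OF assms(5)]])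
    case 2
    then have "?s \<otimes> ?t = \<one>" using len_S[OF assms(5)] assms by (simp add: len_0_iff)
    then have "?s \<otimes> (?s \<otimes> ?t) = ?s \<otimes> \<one>" by simp
    then show ?thesis using neq assms by simp
  qed
  then show False
    using dist_up[OF assms(2,3,1,4)] len_S[OF assms(5)] len_S[OF assms(6)] by simp
qed

text \<open>A \<open>J\<close>-word for the distance is read as a gallery, and \<open>P\<close> is
  pulled back along it from the fixed end \<open>D\<close>. This serves to transport properties
  through residues.\<close>

lemma gallery_induct [consumes 4, case_names base step]:
  assumes "J \<subseteq> S" "C \<in> \<Delta> \<epsilon>" "D \<in> \<Delta> \<epsilon>" "\<delta> C D \<in> generate W J"
    and "P D"
    and step: "\<And>A B s. A \<in> \<Delta> \<epsilon> \<Longrightarrow> B \<in> \<Delta> \<epsilon> \<Longrightarrow> s \<in> J \<Longrightarrow> \<delta> A B = s \<Longrightarrow> P B \<Longrightarrow> P A"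
  shows "P C"
proof -
  obtain us where "set us \<subseteq> J" "\<delta> C D = wp us"
    using assms(1,4) generate_eq_words by auto
  then show ?thesis using assms(2)
  proof (induction us arbitrary: C)
    case Nil
    then show ?case using dist_one_iff assms by auto
  next
    case (Cons s us)
    then have s: "s \<in> J" "s \<in> S" and us: "set us \<subseteq> S" "set us \<subseteq> J" using assms(1) by auto
    obtain B where B: "B \<in> \<Delta> \<epsilon>" "\<delta> C B = s" "\<delta> B D = s \<otimes> \<delta> C D"
      using dist_move[OF Cons.prems(3) assms(3) s(2)] .
    then have "\<delta> B D = wp us" using Cons.prems s us by simp
    then show ?case using Cons.IH[OF us(2)] step[OF Cons.prems(3) B(1) s(1) B(2)] B by simp
  qed
qed

lemma dist_mem_step:
  assumes "J \<subseteq> S" "A \<in> \<Delta> \<epsilon>" "B \<in> \<Delta> \<epsilon>" "D \<in> \<Delta> \<epsilon>" "s \<in> J" "\<delta> A B = s" "\<delta> B D \<in> generate W J"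
  shows "\<delta> A D \<in> generate W J"
  using dist_step[OF assms(3,4,2) subsetD[OF assms(1,5)] assms(6)] assms generate.incl[OF assms(5), of W]
    generate.eng[of s W J "\<delta> B D"] by auto

section \<open>Codistance and opposition\<close>

lemma codist_in [simp]: "C \<in> \<Delta> \<epsilon> \<Longrightarrow> D \<in> \<Delta> (opp_sign \<epsilon>) \<Longrightarrow> \<delta>s C D \<in> carrier W"
  by (rule codist_closed)

text \<open>\<open>Tw2\<close> settles the shortening case. Otherwise \<open>Tw3\<close> provides a
  chamber of the panel with the longer codistance, and \<open>Tw2\<close> started there brings any
  other \<open>E\<close> back to \<open>\<delta>s C D\<close>.\<close>

lemma codist_step:
  assumes "C \<in> \<Delta> \<epsilon>" "D \<in> \<Delta> (opp_sign \<epsilon>)" "E \<in> \<Delta> (opp_sign \<epsilon>)" "s \<in> S" "\<delta> D E = s"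
  shows "\<delta>s C E \<in> {\<delta>s C D, s \<otimes> \<delta>s C D}"
proof (cases rule: len_left_cases[OF assms(4) codist_in[OF assms(1,2)]])
  case 1
  obtain B where B: "B \<in> \<Delta> (opp_sign \<epsilon>)" "\<delta> D B = s" "\<delta>s C B = s \<otimes> \<delta>s C D"
    using Tw3[OF assms(1,2,4)] by blast
  show ?thesis
  proof (cases "B = E")
    case False
    then have "\<delta> B E = s" using panel_trans[OF assms(2) B(1) assms(3,4) B(2) assms(5)] by simp
    then have "\<delta>s C E = s \<otimes> \<delta>s C B"
      using Tw2[OF assms(1) B(1) assms(3,4)] B 1 codist_in[OF assms(1,2)] assms(4) by simp
    then show ?thesis using B codist_in[OF assms(1,2)] assms(4) by simp
  qed (use B in simp)
next
  case 2
  then show ?thesis using Tw2[OF assms] by simp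
qed

lemma codist_down_left:
  assumes "C \<in> \<Delta> \<epsilon>" "B \<in> \<Delta> \<epsilon>" "D \<in> \<Delta> (opp_sign \<epsilon>)" "s \<in> S" "\<delta> C B = s"
    and "len (\<delta>s C D \<otimes> s) + 1 = len (\<delta>s C D)"
  shows "\<delta>s B D = \<delta>s C D \<otimes> s"
proof -
  \<comment> \<open>The axioms read the sign off their first argument; with the arguments exchanged,
    the half of \<open>C\<close> and \<open>B\<close> must appear as a double opposite.\<close>
  have C: "C \<in> \<Delta> (opp_sign (opp_sign \<epsilon>))" and B: "B \<in> \<Delta> (opp_sign (opp_sign \<epsilon>))" using assms by auto
  have w: "\<delta>s C D \<in> carrier W" using assms by simp
  have DC: "\<delta>s D C = inv (\<delta>s C D)" using Tw1 assms by blast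
  have "\<delta>s D B = s \<otimes> \<delta>s D C"
    using Tw2[OF assms(3) C B assms(4,5)] assms(4,6) w unfolding DC
    by (simp add: len_inv len_mult_right)
  then show ?thesis using Tw1[OF assms(3) B] DC w assms(4) by (simp add: inv_mult_group)
qed

lemma Tw3_left:
  assumes "C \<in> \<Delta> \<epsilon>" "D \<in> \<Delta> (opp_sign \<epsilon>)" "s \<in> S"
  obtains B where "B \<in> \<Delta> \<epsilon>" "\<delta> C B = s" "\<delta>s B D = \<delta>s C D \<otimes> s"
proof -
  have C: "C \<in> \<Delta> (opp_sign (opp_sign \<epsilon>))" using assms by auto
  obtain B where B: "B \<in> \<Delta> (opp_sign (opp_sign \<epsilon>))" "\<delta> C B = s" "\<delta>s D B = s \<otimes> \<delta>s D C"
    using Tw3[OF assms(2) C assms(3)] by blast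
  moreover have "\<delta>s B D = \<delta>s C D \<otimes> s"
    using Tw1[OF assms(2) B(1)] Tw1[OF assms(1,2)] B assms by (simp add: inv_mult_group)
  ultimately show thesis using that by simp
qed

lemma codist_sym:
  assumes "C \<in> \<Delta> \<epsilon>" "D \<in> \<Delta> (opp_sign \<epsilon>)" "\<delta>s C D \<in> insert \<one> S"
  shows "\<delta>s D C = \<delta>s C D"
  using Tw1[OF assms(1,2)] assms(3) by auto

lemma codist_walk:
  assumes "J \<subseteq> S" "C \<in> \<Delta> \<epsilon>" "D \<in> \<Delta> (opp_sign \<epsilon>)" "g \<in> generate W J"
  shows "\<exists>E \<in> \<Delta> (opp_sign \<epsilon>). \<delta> D E \<in> generate W J \<and> \<delta>s C E = g \<otimes> \<delta>s C D"
proof -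
  obtain us where "set us \<subseteq> J" "g = wp us"
    using assms(1,4) generate_eq_words by auto
  then show ?thesis using assms(3)
  \<comment> \<open>\<open>Tw3\<close> multiplies on the left, so the first move away from
    \<open>D\<close> accounts for the last letter.\<close>
  proof (induction us arbitrary: D g rule: rev_induct)
    case Nil
    then show ?case
      using dist_one_iff[OF Nil(3,3)] generate.one[of W J] codist_in[OF assms(2) Nil(3)] by force
  next
    case (snoc s us)
    then have s: "s \<in> J" "s \<in> S" and us: "set us \<subseteq> J" "set us \<subseteq> S" using assms(1) by auto
    obtain B where B: "B \<in> \<Delta> (opp_sign \<epsilon>)" "\<delta> D B = s" "\<delta>s C B = s \<otimes> \<delta>s C D"
      using Tw3[OF assms(2) snoc.prems(3) s(2)] by blast
    obtain E where E: "E \<in> \<Delta> (opp_sign \<epsilon>)" "\<delta> B E \<in> generate W J" "\<delta>s C E = wp us \<otimes> \<delta>s C B"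
      using snoc.IH[OF us(1) HOL.refl B(1)] by blast
    have "\<delta>s C E = g \<otimes> \<delta>s C D"
      using E(3) B(3) snoc.prems s us codist_in[OF assms(2) snoc.prems(3)]
      by (simp add: wp_append_S m_assoc)
    moreover have "\<delta> D E \<in> generate W J"
      using dist_mem_step[OF assms(1) snoc.prems(3) B(1) E(1) s(1) B(2) E(2)] .
    ultimately show ?case using E(1) by blast
  qed
qed

lemma codist_attained:
  assumes "C \<in> \<Delta> \<epsilon>" "g \<in> carrier W"
  shows "\<exists>D \<in> \<Delta> (opp_sign \<epsilon>). \<delta>s C D = g"
proof -
  obtain D where D: "D \<in> \<Delta> (opp_sign \<epsilon>)"
    using building.nonempty[OF halves] by blast
  then have c: "\<delta>s C D \<in> carrier W" using assms by simp
  then have "g \<otimes> inv (\<delta>s C D) \<in> generate W S" using assms S_generates by simp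
  then obtain E where "E \<in> \<Delta> (opp_sign \<epsilon>)" "\<delta>s C E = g \<otimes> inv (\<delta>s C D) \<otimes> \<delta>s C D"
    using codist_walk[OF subset_refl assms(1) D] by blast
  then show ?thesis using c assms by (auto simp: m_assoc)
qed

text \<open>Along a minimal gallery from \<open>C\<close> to \<open>E\<close>, \<open>Tw2\<close>
  makes the codistance lose the same letters as the distance, until both are trivial.\<close>

lemma opposite_of_codist_eq_dist:
  assumes "Z \<in> \<Delta> \<epsilon>" "C \<in> \<Delta> (opp_sign \<epsilon>)" "E \<in> \<Delta> (opp_sign \<epsilon>)" "\<delta>s Z C = \<delta> C E"
  shows "\<delta>s Z E = \<one>"
  using assms(2,4)
proof (induction "len (\<delta> C E)" arbitrary: C rule: less_induct)
  case less
  show ?case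
  proof (cases "\<delta> C E = \<one>")
    case True
    then show ?thesis using less dist_one_iff assms by metis
  next
    case False
    then obtain s where s: "s \<in> S" "len (s \<otimes> \<delta> C E) + 1 = len (\<delta> C E)"
      using left_descent_exists less assms by (metis dist_in)
    obtain B where B: "B \<in> \<Delta> (opp_sign \<epsilon>)" "\<delta> C B = s" "\<delta> B E = s \<otimes> \<delta> C E"
      using dist_move[OF less.prems(1) assms(3) s(1)] .
    have "\<delta>s Z B = \<delta> B E"
      using Tw2[OF assms(1) less.prems(1) B(1) s(1) B(2)] s less.prems B by simp
    then show ?thesis using less.hyps[OF _ B(1)] B(3) s(2) by simp
  qed
qed

text \<open>Opposition separates chambers through this \<open>Z\<close>: it is opposite
  \<open>E\<close>, but not opposite \<open>C\<close> unless \<open>C = E\<close>.\<close>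

lemma opposite_at_codist:
  assumes "C \<in> \<Delta> \<epsilon>" "E \<in> \<Delta> \<epsilon>"
  shows "\<exists>Z \<in> \<Delta> (opp_sign \<epsilon>). \<delta>s Z E = \<one> \<and> \<delta>s Z C = \<delta> C E"
proof -
  obtain Z where Z: "Z \<in> \<Delta> (opp_sign \<epsilon>)" "\<delta>s C Z = inv (\<delta> C E)"
    using codist_attained[OF assms(1)] assms by (metis dist_in inv_closed)
  then have "\<delta>s Z C = \<delta> C E" using Tw1[OF assms(1) Z(1)] assms by simp
  then show ?thesis using opposite_of_codist_eq_dist[OF Z(1), of C E] assms Z by auto
qed

text \<open>Seen from \<open>X\<close>, the chambers of the panel have codistance
  \<open>\<one>\<close> or \<open>s\<close>, and \<open>Tw2\<close> drops from a chamber with value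
  \<open>s\<close> to \<open>\<one>\<close> on all the others. So at most one of them fails to be
  opposite \<open>X\<close>.\<close>

lemma panel_opposite:
  assumes "X \<in> \<Delta> \<epsilon>" "E \<in> \<Delta> (opp_sign \<epsilon>)" "C \<in> \<Delta> (opp_sign \<epsilon>)" "D \<in> \<Delta> (opp_sign \<epsilon>)"
    and s: "s \<in> S" and "\<delta> E C = s" "\<delta> E D = s" "C \<noteq> D" "\<delta>s X E = \<one>" "\<delta>s X C \<noteq> \<one>"
  shows "\<delta>s X D = \<one>"
proof -
  have XC: "\<delta>s X C = s" using codist_step[OF assms(1,2,3,5,6)] assms by simp
  have "\<delta> C D = s" using panel_trans[OF assms(2-8)] .
  then show ?thesis using Tw2[OF assms(1,3,4,5)] XC s by (simp add: len_S)
qed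

end

section \<open>Automorphisms interchanging the halves\<close>

locale swapped_twin_building = twin_building W S \<Delta> \<delta> \<delta>s
  for W :: "('w, 'm) monoid_scheme" (structure) and S
    and \<Delta> :: "sign \<Rightarrow> 'c set" and \<delta> and \<delta>s +
  fixes \<theta> :: "'c \<Rightarrow> 'c"
  assumes thick: "thick W S \<Delta> \<delta>"
    and automorphism: "twin_automorphism W S \<Delta> \<delta> \<delta>s \<theta>"
    and swap: "\<theta> ` \<Delta> \<epsilon> = \<Delta> (opp_sign \<epsilon>)"
begin

lemma \<theta>_in [simp]: "C \<in> \<Delta> \<epsilon> \<Longrightarrow> \<theta> C \<in> \<Delta> (opp_sign \<epsilon>)"
  using swap by blast

lemma \<theta>_in_opp [simp]: "C \<in> \<Delta> (opp_sign \<epsilon>) \<Longrightarrow> \<theta> C \<in> \<Delta> \<epsilon>"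
  using \<theta>_in[of C "opp_sign \<epsilon>"] by simp

lemma \<theta>_inj: "C \<in> \<Delta> \<epsilon> \<Longrightarrow> D \<in> \<Delta> \<epsilon> \<Longrightarrow> \<theta> C = \<theta> D \<Longrightarrow> C = D"
  using automorphism unfolding twin_automorphism_def bij_betw_def inj_on_def by blast

lemma \<theta>_surj: "D \<in> \<Delta> (opp_sign \<epsilon>) \<Longrightarrow> \<exists>C \<in> \<Delta> \<epsilon>. D = \<theta> C"
  using swap by blast

lemma \<theta>_adjacent: "C \<in> \<Delta> \<epsilon> \<Longrightarrow> D \<in> \<Delta> \<epsilon> \<Longrightarrow> \<delta> C D \<in> S \<Longrightarrow> \<delta> (\<theta> C) (\<theta> D) \<in> S"
  using automorphism unfolding twin_automorphism_def adjacent_def by blast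

lemma \<theta>_opposite:
  assumes "C \<in> \<Delta> \<epsilon>" "D \<in> \<Delta> (opp_sign \<epsilon>)"
  shows "\<delta>s (\<theta> C) (\<theta> D) = \<one> \<longleftrightarrow> \<delta>s C D = \<one>"
proof -
  have "opposite W \<Delta> \<delta>s C D \<longleftrightarrow> opposite W \<Delta> \<delta>s (\<theta> C) (\<theta> D)"
    using automorphism assms unfolding twin_automorphism_def by blast
  moreover have "opposite W \<Delta> \<delta>s C D \<longleftrightarrow> \<delta>s C D = \<one>"
    using assms unfolding opposite_def by blast
  moreover have "opposite W \<Delta> \<delta>s (\<theta> C) (\<theta> D) \<longleftrightarrow> \<delta>s (\<theta> C) (\<theta> D) = \<one>"
    using \<theta>_in[OF assms(1)] \<theta>_in[OF assms(2)] unfolding opposite_def by blast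
  ultimately show ?thesis by simp
qed

text \<open>The form in which thickness is applied: \<open>B\<close> is a chamber to be avoided
  besides \<open>C\<close>, and stays arbitrary where only existence matters.\<close>

lemma panel_third:
  assumes "C \<in> \<Delta> \<epsilon>" "s \<in> S"
  obtains D where "D \<in> \<Delta> \<epsilon>" "\<delta> C D = s" "D \<noteq> B"
proof -
  let ?P = "{D \<in> \<Delta> \<epsilon>. \<delta> C D \<in> generate W {s}}"
  have "x \<in> {\<one>, s}" if "x \<in> generate W {s}" for x
    using that by induction (use assms(2) in auto)
  then have P: "D = C \<or> \<delta> C D = s" if "D \<in> ?P" for D
    using that dist_one_iff[OF assms(1)] by blast
  have "\<not> ?P \<subseteq> {C, B}"
  proof
    assume sub: "?P \<subseteq> {C, B}"
    have "residue_of_type W \<Delta> \<delta> \<epsilon> {s} ?P" unfolding residue_of_type_def using assms by blast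
    then have "infinite ?P \<or> 3 \<le> card ?P" using thick assms(2) unfolding thick_def by blast
    moreover have "finite ?P" using sub finite_subset by blast
    moreover have "card ?P \<le> card {C, B}" using sub by (intro card_mono) auto
    moreover have "card {C, B} \<le> 2" by (simp add: card_insert_if)
    ultimately show False by linarith
  qed
  then show thesis using P that by blast
qed

section \<open>The action of \<theta> on panels and their types\<close>

lemma \<theta>_same_type:
  assumes "C \<in> \<Delta> \<epsilon>" "D \<in> \<Delta> \<epsilon>" "E \<in> \<Delta> \<epsilon>" "s \<in> S" "\<delta> C D = s" "\<delta> C E = s"
  shows "\<delta> (\<theta> C) (\<theta> D) = \<delta> (\<theta> C) (\<theta> E)"
proof (cases "D = E")
  case False
  have CD: "\<delta> (\<theta> C) (\<theta> D) \<in> S" and CE: "\<delta> (\<theta> C) (\<theta> E) \<in> S"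
    using \<theta>_adjacent[OF assms(1,2)] \<theta>_adjacent[OF assms(1,3)] assms by auto
  have "\<delta> D E = s" using panel_trans[OF assms False] .
  then have "\<delta> (\<theta> D) (\<theta> E) \<in> S" using \<theta>_adjacent[OF assms(2,3)] assms by auto
  moreover have DC: "\<delta> (\<theta> D) (\<theta> C) = \<delta> (\<theta> C) (\<theta> D)"
    using dist_sym[OF \<theta>_in[OF assms(1)] \<theta>_in[OF assms(2)] CD] by simp
  ultimately show ?thesis
    using triangle_type[of "\<theta> D" "opp_sign \<epsilon>" "\<theta> C" "\<theta> E"] CD CE assms by simp
qed simp

text \<open>If \<open>E\<close> were outside the panel of \<open>C\<close> and \<open>D\<close>, some \<open>Z\<close> would be opposite \<open>E\<close> but no chamber of that
  panel, whereas \<open>\<theta> Z\<close>, being opposite \<open>\<theta> E\<close>, misses only one chamber of the panel of \<open>\<theta> E\<close>.\<close>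

lemma \<theta>_panel_reflect:
  assumes C: "C \<in> \<Delta> \<epsilon>" and D: "D \<in> \<Delta> \<epsilon>" and E: "E \<in> \<Delta> \<epsilon>" and s: "s \<in> S"
    and CD: "\<delta> C D = s" and eq: "\<delta> (\<theta> C) (\<theta> E) = \<delta> (\<theta> C) (\<theta> D)"
  shows "\<delta> C E = s"
proof (rule ccontr)
  assume CE: "\<delta> C E \<noteq> s"
  let ?a = "\<delta> (\<theta> C) (\<theta> D)"
  have a: "?a \<in> S" using \<theta>_adjacent[OF C D] CD s by simp
  have DE: "D \<noteq> E" using CE CD by auto
  have "E \<noteq> C" using eq S_not_one[OF a] dist_one_iff[OF \<theta>_in[OF C] \<theta>_in[OF C]] by metis
  define P where "P = {B \<in> \<Delta> \<epsilon>. B = C \<or> \<delta> C B = s}"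
  have P: "\<delta> A B = s" if "A \<in> P" "B \<in> P" "A \<noteq> B" for A B
    using that panel_trans[OF C _ _ s] dist_sym[OF C _ s] unfolding P_def by auto
  have P_closed: "B \<in> P" if "A \<in> P" "B \<in> \<Delta> \<epsilon>" "\<delta> A B = s" for A B
    using that panel_trans[OF _ C _ s] dist_sym[OF C _ s] unfolding P_def by blast
  have "E \<notin> P" using CE \<open>E \<noteq> C\<close> P_def by auto
  \<comment> \<open>\<open>A\<close> is the chamber of the panel \<open>P\<close> nearest to
    \<open>E\<close>: either \<open>C\<close> itself or a chamber one step across.\<close>
  obtain A where A: "A \<in> P" "len (s \<otimes> \<delta> A E) = len (\<delta> A E) + 1"
  proof (cases rule: len_left_cases[OF s dist_in[OF C E]])
    case 1
    then show thesis using that C unfolding P_def by blast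
  next
    case 2
    obtain B where "B \<in> \<Delta> \<epsilon>" "\<delta> C B = s" "\<delta> B E = s \<otimes> \<delta> C E" using dist_move[OF C E s] .
    then show thesis using that[of B] 2 s C E unfolding P_def by simp
  qed
  have A': "A \<in> \<Delta> \<epsilon>" using A P_def by simp
  let ?u = "\<delta> A E"
  have u: "?u \<noteq> \<one>" "?u \<in> carrier W" using A \<open>E \<notin> P\<close> dist_one_iff[OF A' E] A' E by auto
  obtain B where B: "B \<in> \<Delta> \<epsilon>" "\<delta> A B = s" "\<delta> B E = s \<otimes> ?u" using dist_move[OF A' E s] .
  have BP: "B \<in> P" using P_closed A B by blast
  \<comment> \<open>The codistance from \<open>Z\<close> is longest at \<open>B\<close> and hence,
    by \<open>Tw2\<close>, equal to \<open>?u\<close> on the rest of \<open>P\<close>. Neither value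
    is \<open>\<one>\<close>, since \<open>E\<close> lies outside \<open>P\<close>.\<close>
  obtain Z where Z: "Z \<in> \<Delta> (opp_sign \<epsilon>)" "\<delta>s Z E = \<one>" "\<delta>s Z B = s \<otimes> ?u"
    using opposite_at_codist[OF B(1) E] B(3) by auto
  have no: "\<delta>s Z X \<noteq> \<one>" if X: "X \<in> P" for X
  proof (cases "X = B")
    case True
    then show ?thesis using Z(3) A(2) by auto
  next
    case False
    then have "\<delta> B X = s" using P X BP by blast
    then have "\<delta>s Z X = s \<otimes> \<delta>s Z B"
      using Tw2[OF Z(1), of B X s] B X Z A(2) s u unfolding P_def by simp
    then show ?thesis using Z s u by simp
  qed
  have ZE: "\<delta>s (\<theta> Z) (\<theta> E) = \<one>" and ZC: "\<delta>s (\<theta> Z) (\<theta> C) \<noteq> \<one>" and ZD: "\<delta>s (\<theta> Z) (\<theta> D) \<noteq> \<one>"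
    using \<theta>_opposite[OF Z(1)] E C D Z no[of C] no[of D] CD P_def by auto
  have EC: "\<delta> (\<theta> E) (\<theta> C) = ?a" using dist_sym[OF \<theta>_in[OF C] \<theta>_in[OF E] a eq] .
  have "\<theta> E \<noteq> \<theta> D" using \<theta>_inj[OF E D] DE by blast
  then have ED: "\<delta> (\<theta> E) (\<theta> D) = ?a"
    using panel_trans[OF \<theta>_in[OF C] \<theta>_in[OF E] \<theta>_in[OF D] a eq] by simp
  have "\<theta> C \<noteq> \<theta> D" using S_not_one[OF a] dist_one_iff[OF \<theta>_in[OF C] \<theta>_in[OF D]] by metis
  then have "\<delta>s (\<theta> Z) (\<theta> D) = \<one>"
    using panel_opposite[OF _ \<theta>_in[OF E] \<theta>_in[OF C] \<theta>_in[OF D] a EC ED _ ZE ZC] Z(1) by simp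
  then show False using ZD by simp
qed

text \<open>In the image panel of \<open>C\<close>, pick the chamber \<open>\<theta> c\<close> at
  codistance \<open>?a\<close> from \<open>\<theta> X\<close>. Its preimage \<open>c\<close> is not
  opposite \<open>X\<close>, hence is opposite \<open>Y\<close>, so crossing from
  \<open>\<theta> X\<close> to \<open>\<theta> Y\<close> must cancel \<open>?a\<close>; this is
  possible only if \<open>?b = ?a\<close>.\<close>

lemma \<theta>_type_opposite:
  assumes C: "C \<in> \<Delta> \<epsilon>" and D: "D \<in> \<Delta> \<epsilon>" and X: "X \<in> \<Delta> (opp_sign \<epsilon>)" and Y: "Y \<in> \<Delta> (opp_sign \<epsilon>)"
    and s: "s \<in> S" and CD: "\<delta> C D = s" and XY: "\<delta> X Y = s" and CX: "\<delta>s C X = \<one>"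
  shows "\<delta> (\<theta> C) (\<theta> D) = \<delta> (\<theta> X) (\<theta> Y)"
proof (rule ccontr)
  let ?a = "\<delta> (\<theta> C) (\<theta> D)" and ?b = "\<delta> (\<theta> X) (\<theta> Y)"
  assume neq: "?a \<noteq> ?b"
  have a: "?a \<in> S" using \<theta>_adjacent[OF C D] CD s by simp
  have b: "?b \<in> S" using \<theta>_adjacent[OF X Y] XY s by simp
  have XC: "\<delta>s X C = \<one>" using codist_sym[OF C X] CX by simp
  have XC': "\<delta>s (\<theta> X) (\<theta> C) = \<one>" using \<theta>_opposite[OF X] C XC by simp
  obtain c0 where c0: "c0 \<in> \<Delta> (opp_sign \<epsilon>)" "\<delta> (\<theta> C) c0 = ?a" "\<delta>s (\<theta> X) c0 = ?a"
    using Tw3[of "\<theta> X" \<epsilon> "\<theta> C" ?a] X C a XC' by auto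
  obtain c where c: "c \<in> \<Delta> \<epsilon>" "c0 = \<theta> c" using \<theta>_surj[OF c0(1)] by blast
  have Cc: "\<delta> C c = s" using \<theta>_panel_reflect[OF C D c(1) s CD] c0 c by simp
  have "\<delta>s X c \<in> {\<one>, s}" using codist_step[OF X, of C c s] C c s Cc XC by simp
  moreover have "\<delta>s X c \<noteq> \<one>" using \<theta>_opposite[OF X, of c] c c0 S_not_one[OF a] by simp
  ultimately have Xc: "\<delta>s X c = s" by simp
  then have cX: "\<delta>s c X = s" using codist_sym[OF X, of c] c s by simp
  then have "\<delta>s c Y = \<one>" using Tw2[OF c(1) X Y s XY] s by (simp add: len_S)
  then have cY': "\<delta>s (\<theta> c) (\<theta> Y) = \<one>" using \<theta>_opposite[OF c(1) Y] by simp
  have "\<delta>s (\<theta> c) (\<theta> X) = ?a" using codist_sym[of "\<theta> X" \<epsilon> "\<theta> c"] X c c0 a by simp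
  then have "\<one> \<in> {?a, ?b \<otimes> ?a}"
    using codist_step[OF \<theta>_in[OF c(1)], of "\<theta> X" "\<theta> Y" ?b] X Y b cY' by simp
  then have "?b \<otimes> \<one> = ?b \<otimes> (?b \<otimes> ?a)" using S_not_one[OF a] by auto
  then show False using a b neq by simp
qed

text \<open>If an opposite \<open>X\<close> of \<open>C\<close> fails for \<open>E\<close>, its
  \<open>r\<close>-panel helps: only \<open>Y\<close> is not opposite \<open>C\<close> there and
  only \<open>X\<close> is not opposite \<open>E\<close>, so a third chamber \<open>Z\<close> serves
  both.\<close>

lemma common_opposite:
  assumes C: "C \<in> \<Delta> \<epsilon>" and E: "E \<in> \<Delta> \<epsilon>" and r: "r \<in> S" and CE: "\<delta> C E = r"
  shows "\<exists>X \<in> \<Delta> (opp_sign \<epsilon>). \<delta>s C X = \<one> \<and> \<delta>s E X = \<one>"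
proof -
  obtain X where X: "X \<in> \<Delta> (opp_sign \<epsilon>)" "\<delta>s C X = \<one>" using codist_attained[OF C] by blast
  have XC: "\<delta>s X C = \<one>" using codist_sym[OF C X(1)] X by simp
  show ?thesis
  proof (cases "\<delta>s E X = \<one>")
    case True
    then show ?thesis using X by blast
  next
    case False
    then have "\<delta>s X E \<noteq> \<one>" using codist_sym[OF X(1), of E] E by auto
    then have "\<delta>s X E = r" using codist_step[OF X(1), of C E r] C E r CE XC by simp
    then have EX: "\<delta>s E X = r" using codist_sym[OF X(1), of E] E r by simp
    obtain Y where Y: "Y \<in> \<Delta> (opp_sign \<epsilon>)" "\<delta> X Y = r" "\<delta>s C Y = r \<otimes> \<delta>s C X"
      using Tw3[OF C X(1) r] by blast
    have CY: "\<delta>s C Y = r" using Y X r by simp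
    obtain Z where Z: "Z \<in> \<Delta> (opp_sign \<epsilon>)" "\<delta> X Z = r" "Z \<noteq> Y" using panel_third[OF X(1) r] .
    have "\<delta> Y Z = r" using panel_trans[OF X(1) Y(1) Z(1) r Y(2) Z(2)] Z(3) by blast
    then have "\<delta>s C Z = \<one>" using Tw2[OF C Y(1) Z(1) r] CY r by (simp add: len_S)
    moreover have "\<delta>s E Z = \<one>" using Tw2[OF E X(1) Z(1) r Z(2)] EX r by (simp add: len_S)
    ultimately show ?thesis using Z by blast
  qed
qed

text \<open>Adjacent chambers have a common opposite, and the image type passes to that chamber and
  back. A gallery from \<open>C\<close> to \<open>E\<close> does the rest.\<close>

lemma \<theta>_type_constant:
  assumes C: "C \<in> \<Delta> \<epsilon>" and E: "E \<in> \<Delta> \<epsilon>" and s: "s \<in> S"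
    and D: "D \<in> \<Delta> \<epsilon>" "\<delta> C D = s" and F: "F \<in> \<Delta> \<epsilon>" "\<delta> E F = s"
  shows "\<delta> (\<theta> C) (\<theta> D) = \<delta> (\<theta> E) (\<theta> F)"
proof -
  have "\<delta> C E \<in> generate W S" using C E S_generates by simp
  from subset_refl C E this D show ?thesis
  proof (induction arbitrary: D rule: gallery_induct)
    case base
    then show ?case using \<theta>_same_type[OF E _ F(1) s _ F(2)] by blast
  next
    case (step A B r)
    obtain X where X: "X \<in> \<Delta> (opp_sign \<epsilon>)" "\<delta>s A X = \<one>" "\<delta>s B X = \<one>"
      using common_opposite[OF step(1-4)] by blast
    obtain Y where Y: "Y \<in> \<Delta> (opp_sign \<epsilon>)" "\<delta> X Y = s" using panel_third[OF X(1) s] .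
    obtain G where G: "G \<in> \<Delta> \<epsilon>" "\<delta> B G = s" using panel_third[OF step(2) s] .
    have "\<delta> (\<theta> A) (\<theta> D) = \<delta> (\<theta> X) (\<theta> Y)"
      using \<theta>_type_opposite[OF step(1,6) X(1) Y(1) s step(7) Y(2) X(2)] .
    moreover have "\<delta> (\<theta> B) (\<theta> G) = \<delta> (\<theta> X) (\<theta> Y)"
      using \<theta>_type_opposite[OF step(2) G(1) X(1) Y(1) s G(2) Y(2) X(3)] .
    ultimately show ?case using step(5)[OF G] by simp
  qed
qed

lemma type_map:
  assumes "finite S"
  obtains \<sigma> where "\<sigma> ` S = S"
    "\<And>C D s. C \<in> \<Delta> \<epsilon> \<Longrightarrow> D \<in> \<Delta> \<epsilon> \<Longrightarrow> s \<in> S \<Longrightarrow> \<delta> C D = s \<longleftrightarrow> \<delta> (\<theta> C) (\<theta> D) = \<sigma> s"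
proof -
  obtain C where C: "C \<in> \<Delta> \<epsilon>" using building.nonempty[OF halves] by blast
  have "\<forall>s \<in> S. \<exists>D. D \<in> \<Delta> \<epsilon> \<and> \<delta> C D = s" using panel_third[OF C] by metis
  then obtain f where f: "f s \<in> \<Delta> \<epsilon>" "\<delta> C (f s) = s" if "s \<in> S" for s by metis
  define \<sigma> where "\<sigma> s = \<delta> (\<theta> C) (\<theta> (f s))" for s
  have fwd: "\<delta> (\<theta> A) (\<theta> B) = \<sigma> s" if "A \<in> \<Delta> \<epsilon>" "B \<in> \<Delta> \<epsilon>" "s \<in> S" "\<delta> A B = s" for A B s
    using \<theta>_type_constant[OF that(1) C that(3,2,4) f] that(3) unfolding \<sigma>_def by blast
  have bwd: "\<delta> A B = s" if A: "A \<in> \<Delta> \<epsilon>" "B \<in> \<Delta> \<epsilon>" "s \<in> S" "\<delta> (\<theta> A) (\<theta> B) = \<sigma> s" for A B s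
  proof -
    obtain D where D: "D \<in> \<Delta> \<epsilon>" "\<delta> A D = s" using panel_third[OF A(1,3)] .
    show ?thesis using \<theta>_panel_reflect[OF A(1) D(1) A(2,3) D(2)] fwd[OF A(1) D(1) A(3) D(2)] A(4) by simp
  qed
  have "\<sigma> ` S \<subseteq> S" unfolding \<sigma>_def using \<theta>_adjacent[OF C] f by auto
  moreover have "inj_on \<sigma> S"
  proof (rule inj_onI)
    fix s t assume st: "s \<in> S" "t \<in> S" "\<sigma> s = \<sigma> t"
    then have "\<delta> C (f s) = t" using bwd[OF C f(1)] fwd[OF C f(1)] f(2) by simp
    then show "s = t" using f st by simp
  qed
  \<comment> \<open>Injectivity came from \<open>bwd\<close>; finiteness of \<open>S\<close> turns
    it into surjectivity.\<close>
  ultimately have "\<sigma> ` S = S" using assms endo_inj_surj by blast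
  then show thesis
    by (rule that) (use fwd bwd in blast)
qed

text \<open>Minimality of \<open>w = \<delta>s C (\<theta> C)\<close> together with a third chamber in the \<open>s\<close>-panel of \<open>C\<close> forces
  every descent of \<open>w\<close> to be a twisted commutation.\<close>

lemma minimal_descents:
  assumes C: "C \<in> \<Delta> \<epsilon>" and s: "s \<in> S" "s' \<in> S"
    and type: "\<And>D. D \<in> \<Delta> \<epsilon> \<Longrightarrow> \<delta> C D = s \<Longrightarrow> \<delta> (\<theta> C) (\<theta> D) = s'"
    and min: "\<And>D. D \<in> \<Delta> \<epsilon> \<Longrightarrow> len (\<delta>s C (\<theta> C)) \<le> len (\<delta>s D (\<theta> D))"
    and desc: "len (s' \<otimes> \<delta>s C (\<theta> C)) + 1 = len (\<delta>s C (\<theta> C)) \<or>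
      len (\<delta>s C (\<theta> C) \<otimes> s) + 1 = len (\<delta>s C (\<theta> C))"
  shows "s' \<otimes> \<delta>s C (\<theta> C) = \<delta>s C (\<theta> C) \<otimes> s"
proof (rule ccontr)
  let ?w = "\<delta>s C (\<theta> C)"
  assume neq: "s' \<otimes> ?w \<noteq> ?w \<otimes> s"
  have TC: "\<theta> C \<in> \<Delta> (opp_sign \<epsilon>)" and w: "?w \<in> carrier W" using C by auto
  \<comment> \<open>The pair \<open>(C, \<theta> C)\<close> is moved to
    \<open>(D, \<theta> D)\<close> one coordinate at a time: \<open>left\<close> moves the second
    coordinate last, \<open>right\<close> the first.\<close>
  have left: "\<delta>s D (\<theta> D) = s' \<otimes> \<delta>s D (\<theta> C)"
    if "D \<in> \<Delta> \<epsilon>" "\<delta> C D = s" "len (s' \<otimes> \<delta>s D (\<theta> C)) + 1 = len (\<delta>s D (\<theta> C))" for D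
    using Tw2[OF that(1) TC _ s(2) type[OF that(1,2)] that(3)] that by simp
  have right: "\<delta>s D (\<theta> D) = \<delta>s C (\<theta> D) \<otimes> s"
    if "D \<in> \<Delta> \<epsilon>" "\<delta> C D = s" "len (\<delta>s C (\<theta> D) \<otimes> s) + 1 = len (\<delta>s C (\<theta> D))" for D
    using codist_down_left[OF C that(1) \<theta>_in[OF that(1)] s(1) that(2,3)] .
  from desc show False
  proof
    assume d: "len (s' \<otimes> ?w) + 1 = len ?w"
    let ?v = "s' \<otimes> ?w"
    have v: "?v \<in> carrier W" using w s by simp
    show False
    proof (cases rule: len_right_cases[OF s(1) v])
      case 1
      have "?v \<otimes> s \<noteq> ?w"
      proof
        assume "?v \<otimes> s = ?w"
        then have "?v \<otimes> s \<otimes> s = ?w \<otimes> s" by simp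
        then show False using neq s v by simp
      qed
      then have "len (s' \<otimes> ?v \<otimes> s) = len ?v + 2"
        using lift_both_sides[OF s(1,2) v _ 1] d s w by auto
      then have up: "len (?w \<otimes> s) = len ?w + 1" using d s w by simp
      \<comment> \<open>\<open>B\<close> takes the long value \<open>?w \<otimes> s\<close>, so the
        third chamber \<open>D\<close> has codistance \<open>?w\<close> from
        \<open>\<theta> C\<close>, and passing to \<open>\<theta> D\<close> falls below the
        minimum.\<close>
      obtain B where B: "B \<in> \<Delta> \<epsilon>" "\<delta> C B = s" "\<delta>s B (\<theta> C) = ?w \<otimes> s" using Tw3_left[OF C TC s(1)] .
      obtain D where D: "D \<in> \<Delta> \<epsilon>" "\<delta> C D = s" "D \<noteq> B" using panel_third[OF C s(1)] .
      have "\<delta> B D = s" using panel_trans[OF C B(1) D(1) s(1) B(2) D(2)] D(3) by blast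
      then have "\<delta>s D (\<theta> C) = ?w"
        using codist_down_left[OF B(1) D(1) TC s(1)] B up s w by simp
      then show False using left[OF D(1,2)] d min[OF D(1)] by simp
    next
      case 2
      \<comment> \<open>Both multiplications shorten, so moving the second coordinate and then the
        first ends two below the minimum.\<close>
      obtain D where D: "D \<in> \<Delta> \<epsilon>" "\<delta> C D = s" using panel_third[OF C s(1)] .
      have "\<delta>s C (\<theta> D) = ?v" using Tw2[OF C TC \<theta>_in[OF D(1)] s(2) type[OF D] d] .
      then show False using right[OF D] 2 d min[OF D(1)] by simp
    qed
  next
    assume d: "len (?w \<otimes> s) + 1 = len ?w"
    let ?v = "?w \<otimes> s"
    have v: "?v \<in> carrier W" using w s by simp
    show False
    proof (cases rule: len_left_cases[OF s(2) v])
      case 1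
      have "s' \<otimes> ?v \<noteq> ?v \<otimes> s"
      proof
        assume "s' \<otimes> ?v = ?v \<otimes> s"
        then have "s' \<otimes> (s' \<otimes> ?v) = s' \<otimes> ?w" using s w by simp
        then show False using neq s w by simp
      qed
      then have "len (s' \<otimes> ?v \<otimes> s) = len ?v + 2"
        using lift_both_sides[OF s(1,2) v 1] d s w by auto
      moreover have "s' \<otimes> ?v \<otimes> s = s' \<otimes> ?w" using s w by (simp add: m_assoc)
      ultimately have up: "len (s' \<otimes> ?w) = len ?w + 1" using d by simp
      obtain B where B: "B \<in> \<Delta> (opp_sign \<epsilon>)" "\<delta> (\<theta> C) B = s'" "\<delta>s C B = s' \<otimes> ?w"
        using Tw3[OF C TC s(2)] by blast
      \<comment> \<open>In this mirror case the long value sits in the panel of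
        \<open>\<theta> C\<close>, so the third chamber has to avoid the preimage
        \<open>B'\<close>.\<close>
      obtain B' where B': "B' \<in> \<Delta> \<epsilon>" "B = \<theta> B'" using \<theta>_surj[OF B(1)] by blast
      obtain D where D: "D \<in> \<Delta> \<epsilon>" "\<delta> C D = s" "D \<noteq> B'" using panel_third[OF C s(1)] .
      have "B \<noteq> \<theta> D" using \<theta>_inj[OF B'(1) D(1)] D(3) B'(2) by metis
      then have "\<delta> B (\<theta> D) = s'"
        using panel_trans[OF TC B(1) \<theta>_in[OF D(1)] s(2) B(2) type[OF D(1,2)]] by blast
      then have "\<delta>s C (\<theta> D) = ?w"
        using Tw2[OF C B(1) \<theta>_in[OF D(1)] s(2)] B up s w by simp
      then show False using right[OF D(1,2)] d min[OF D(1)] by simp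
    next
      case 2
      obtain D where D: "D \<in> \<Delta> \<epsilon>" "\<delta> C D = s" using panel_third[OF C s(1)] .
      have "\<delta>s D (\<theta> C) = ?v" using codist_down_left[OF C D(1) TC s(1) D(2) d] .
      then show False using left[OF D] 2 d min[OF D(1)] by simp
    qed
  qed
qed

text \<open>\<theta> relabels an \<open>s\<close>-step as a \<open>\<sigma> s\<close>-step, and
  \<open>type\<close> also reflects such steps, so galleries inside the two residues
  correspond.\<close>

lemma image_residue:
  assumes K: "K \<subseteq> S" and \<sigma>: "\<sigma> ` K \<subseteq> S" and C: "C \<in> \<Delta> \<epsilon>"
    and type: "\<And>C D s. C \<in> \<Delta> \<epsilon> \<Longrightarrow> D \<in> \<Delta> \<epsilon> \<Longrightarrow> s \<in> S \<Longrightarrow> \<delta> C D = s \<longleftrightarrow> \<delta> (\<theta> C) (\<theta> D) = \<sigma> s"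
  shows "\<theta> ` {D \<in> \<Delta> \<epsilon>. \<delta> C D \<in> generate W K}
       = {D \<in> \<Delta> (opp_sign \<epsilon>). \<delta> (\<theta> C) D \<in> generate W (\<sigma> ` K)}"
proof -
  have "\<delta> C D \<in> generate W K \<longleftrightarrow> \<delta> (\<theta> C) (\<theta> D) \<in> generate W (\<sigma> ` K)" if D: "D \<in> \<Delta> \<epsilon>" for D
  proof
    have one: "\<delta> B B = \<one>" if "B \<in> \<Delta> \<eta>" for B \<eta> using that dist_one_iff by blast
    assume "\<delta> C D \<in> generate W K"
    with K C D show "\<delta> (\<theta> C) (\<theta> D) \<in> generate W (\<sigma> ` K)"
    proof (induction rule: gallery_induct)
      case base
      then show ?case using one[OF \<theta>_in[OF D]] generate.one[of W] by simp
    next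
      case (step A B s)
      then show ?case
        using dist_mem_step[OF \<sigma> \<theta>_in[OF step(1)] \<theta>_in[OF step(2)] \<theta>_in[OF D], of "\<sigma> s"] type K by blast
    qed
  next
    assume "\<delta> (\<theta> C) (\<theta> D) \<in> generate W (\<sigma> ` K)"
    with \<sigma> \<theta>_in[OF C] \<theta>_in[OF D]
    \<comment> \<open>The gallery runs through image chambers, so the claim quantifies over
      preimages of its moving end.\<close>
    have "\<forall>A \<in> \<Delta> \<epsilon>. \<theta> A = \<theta> C \<longrightarrow> \<delta> A D \<in> generate W K"
    proof (induction rule: gallery_induct)
      case base
      then show ?case using \<theta>_inj[OF _ D] dist_one_iff[OF D D] generate.one[of W K] by metis
    next
      case (step A' B' s')
      then obtain B t where B: "B \<in> \<Delta> \<epsilon>" "B' = \<theta> B" and t: "t \<in> K" "s' = \<sigma> t" using \<theta>_surj by blast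
      show ?case
      proof (intro ballI impI)
        fix A assume A: "A \<in> \<Delta> \<epsilon>" "\<theta> A = A'"
        then have "\<delta> A B = t" using type[OF A(1) B(1), of t] t K B step by auto
        then show "\<delta> A D \<in> generate W K" using dist_mem_step[OF K A(1) B(1) D t(1)] step B by blast
      qed
    qed
    then show "\<delta> C D \<in> generate W K" using C by blast
  qed
  then show ?thesis using \<theta>_surj[of _ \<epsilon>] by (auto simp: image_iff) blast
qed

end

theorem proposition1p1:
  fixes W :: "('w, 'm) monoid_scheme"
    and S :: "'w set"
    and \<Delta> :: "sign \<Rightarrow> 'c set"
    and \<delta> \<delta>s :: "'c \<Rightarrow> 'c \<Rightarrow> 'w"
    and \<theta> :: "'c \<Rightarrow> 'c"
  assumes "coxeter_system W S"
    and "finite S"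
    and "irreducible_coxeter W S"
    and "twin_building W S \<Delta> \<delta> \<delta>s"
    and "thick W S \<Delta> \<delta>"
    and "twin_automorphism W S \<Delta> \<delta> \<delta>s \<theta>"
    and "\<theta> ` \<Delta> Plus = \<Delta> Minus"
    and "\<theta> ` \<Delta> Minus = \<Delta> Plus"
  shows "\<exists>R. spherical_residue W S \<Delta> \<delta> R \<and> opposite_residues W S \<Delta> \<delta> \<delta>s (\<theta> ` R) R"
proof -
  interpret twin_building W S \<Delta> \<delta> \<delta>s by fact
  interpret swapped_twin_building W S \<Delta> \<delta> \<delta>s \<theta>
  proof
    show "\<theta> ` \<Delta> \<epsilon> = \<Delta> (opp_sign \<epsilon>)" for \<epsilon> using assms(7,8) by (cases \<epsilon>) auto
  qed fact+
  let ?G = "generate W"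
  obtain \<sigma> where \<sigma>: "\<sigma> ` S = S" and type:
    "\<And>C D s. C \<in> \<Delta> Plus \<Longrightarrow> D \<in> \<Delta> Plus \<Longrightarrow> s \<in> S \<Longrightarrow> \<delta> C D = s \<longleftrightarrow> \<delta> (\<theta> C) (\<theta> D) = \<sigma> s"
    using type_map[OF assms(2), of Plus] by metis
  obtain C0 where "C0 \<in> \<Delta> Plus" using building.nonempty[OF halves] by blast
  then obtain C where C: "C \<in> \<Delta> Plus"
    and min: "\<And>D. D \<in> \<Delta> Plus \<Longrightarrow> len (\<delta>s C (\<theta> C)) \<le> len (\<delta>s D (\<theta> D))"
    using ex_has_least_nat[of "\<lambda>C. C \<in> \<Delta> Plus" C0 "\<lambda>C. len (\<delta>s C (\<theta> C))"] by blast
  have \<theta>C: "\<theta> C \<in> \<Delta> (opp_sign Plus)" using C by (rule \<theta>_in)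
  define w where "w = \<delta>s C (\<theta> C)"
  have w: "w \<in> carrier W" unfolding w_def using codist_in[OF C \<theta>C] .
  have desc: "\<sigma> s \<otimes>\<^bsub>W\<^esub> w = w \<otimes>\<^bsub>W\<^esub> s"
    if "s \<in> S" "len (\<sigma> s \<otimes>\<^bsub>W\<^esub> w) + 1 = len w \<or> len (w \<otimes>\<^bsub>W\<^esub> s) + 1 = len w" for s
    unfolding w_def
    by (rule minimal_descents[OF C that(1) _ _ min that(2)[unfolded w_def]])
      (use \<sigma> that(1) type[OF C _ that(1)] in auto)
  define K where "K = {s \<in> S. len (w \<otimes>\<^bsub>W\<^esub> s) + 1 = len w}"
  define J where "J = \<sigma> ` K"
  have K: "K \<subseteq> S" and J: "J \<subseteq> S" unfolding J_def K_def using \<sigma> by auto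
  have comm: "\<sigma> s \<otimes>\<^bsub>W\<^esub> w = w \<otimes>\<^bsub>W\<^esub> s" if "s \<in> K" for s using desc that unfolding K_def by blast
  have wJ: "w \<in> ?G J"
  proof (rule mem_parabolic_of_descents[OF w J])
    fix t assume "t \<in> S" "len (w \<otimes>\<^bsub>W\<^esub> t) + 1 = len w"
    then have "t \<in> K" unfolding K_def by blast
    then show "\<exists>s\<in>J. s \<otimes>\<^bsub>W\<^esub> w = w \<otimes>\<^bsub>W\<^esub> t" using comm unfolding J_def by blast
  qed
  have "finite (?G J)"
  proof (rule finite_parabolic_of_descents[OF assms(2) w _ J])
    fix s assume "s \<in> J"
    then obtain t where "t \<in> K" "s = \<sigma> t" unfolding J_def by blast
    then show "len (s \<otimes>\<^bsub>W\<^esub> w) < len w" using comm[of t] unfolding K_def by auto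
  qed
  interpret GJ: subgroup "?G J" W using parabolic_subgroup[OF J] .
  interpret GK: subgroup "?G K" W using parabolic_subgroup[OF K] .
  \<comment> \<open>Right descents of the inverse are left descents of \<open>w\<close>; each is
    \<open>\<sigma> s\<close> for some \<open>s\<close>, and \<open>desc\<close> puts that
    \<open>s\<close> into \<open>K\<close>.\<close>
  have wK: "inv\<^bsub>W\<^esub> w \<in> ?G K"
  proof (rule mem_parabolic_of_descents[OF inv_closed[OF w] K])
    fix t assume t: "t \<in> S" "len (inv\<^bsub>W\<^esub> w \<otimes>\<^bsub>W\<^esub> t) + 1 = len (inv\<^bsub>W\<^esub> w)"
    then have left: "len (t \<otimes>\<^bsub>W\<^esub> w) + 1 = len w" using w by (simp add: len_mult_right len_inv)
    obtain s where s: "s \<in> S" "t = \<sigma> s" using \<sigma> t by blast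
    then have tw: "t \<otimes>\<^bsub>W\<^esub> w = w \<otimes>\<^bsub>W\<^esub> s" using desc left by blast
    then have "s \<in> K" using left s unfolding K_def by simp
    moreover have "s \<otimes>\<^bsub>W\<^esub> inv\<^bsub>W\<^esub> w = inv\<^bsub>W\<^esub> w \<otimes>\<^bsub>W\<^esub> (w \<otimes>\<^bsub>W\<^esub> s) \<otimes>\<^bsub>W\<^esub> inv\<^bsub>W\<^esub> w"
      using s w by (simp flip: m_assoc)
    then have "s \<otimes>\<^bsub>W\<^esub> inv\<^bsub>W\<^esub> w = inv\<^bsub>W\<^esub> w \<otimes>\<^bsub>W\<^esub> t"
      using t w by (simp add: m_assoc flip: tw)
    ultimately show "\<exists>s\<in>K. s \<otimes>\<^bsub>W\<^esub> inv\<^bsub>W\<^esub> w = inv\<^bsub>W\<^esub> w \<otimes>\<^bsub>W\<^esub> t" by blast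
  qed
  \<comment> \<open>Conjugation by \<open>w\<close> matches \<open>K\<close> with \<open>J\<close>.
    As \<open>w\<close> lies in both parabolic subgroups, each of them contains the generators of
    the other.\<close>
  have "K \<subseteq> ?G J"
  proof
    fix s assume s: "s \<in> K"
    then have "s = inv\<^bsub>W\<^esub> w \<otimes>\<^bsub>W\<^esub> (\<sigma> s \<otimes>\<^bsub>W\<^esub> w)"
      using comm[OF s] w K by (auto simp flip: m_assoc)
    moreover have "\<sigma> s \<in> ?G J" using s generate.incl[of "\<sigma> s" J W] unfolding J_def by blast
    ultimately show "s \<in> ?G J" using wJ by (metis GJ.m_closed GJ.m_inv_closed)
  qed
  then have "?G K \<subseteq> ?G J" using generate_subgroup_incl[OF _ GJ.subgroup_axioms] by blast
  then have fin: "finite (?G K)" using \<open>finite (?G J)\<close> finite_subset by blast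
  have "J \<subseteq> ?G K"
  proof
    fix t assume "t \<in> J"
    then obtain s where s: "s \<in> K" "t = \<sigma> s" unfolding J_def by blast
    have tc: "t \<in> carrier W" using \<open>t \<in> J\<close> J by blast
    have "inv\<^bsub>W\<^esub> (inv\<^bsub>W\<^esub> w) \<otimes>\<^bsub>W\<^esub> s \<otimes>\<^bsub>W\<^esub> inv\<^bsub>W\<^esub> w = t"
      using comm[OF s(1)] s(2) tc w by (simp add: m_assoc flip: comm[OF s(1)])
    moreover have "s \<in> ?G K" using s generate.incl[of s K W] by blast
    ultimately show "t \<in> ?G K" using wK by (metis GK.m_closed GK.m_inv_closed)
  qed
  then have JK: "?G J \<subseteq> ?G K" using generate_subgroup_incl[OF _ GK.subgroup_axioms] by blast
  define R where "R = {D \<in> \<Delta> Plus. \<delta> C D \<in> ?G K}"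
  have R: "residue_of_type W \<Delta> \<delta> Plus K R" unfolding residue_of_type_def R_def using C by blast
  have \<theta>R: "\<theta> ` R = {D \<in> \<Delta> (opp_sign Plus). \<delta> (\<theta> C) D \<in> ?G J}"
    using image_residue[OF K _ C type] J unfolding R_def J_def by blast
  then have \<theta>R_type: "residue_of_type W \<Delta> \<delta> Minus J (\<theta> ` R)"
    unfolding residue_of_type_def using \<theta>C by auto
  have "\<exists>E\<in>R. opposite W \<Delta> \<delta>s D E" if "D \<in> \<theta> ` R" for D
  proof -
    have D: "D \<in> \<Delta> (opp_sign Plus)" "\<delta> (\<theta> C) D \<in> ?G J" using that \<theta>R by auto
    \<comment> \<open>The induction fixes the end \<open>D\<close> and moves the start, so
      membership is phrased as an implication towards \<open>D\<close>. Each step changes the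
      codistance by at most a factor from \<open>J\<close>.\<close>
    from J \<theta>C D have "\<delta>s C (\<theta> C) \<in> ?G J \<longrightarrow> \<delta>s C D \<in> ?G J"
    proof (induction rule: gallery_induct)
      case (step A B s)
      then have "s \<in> ?G J" "\<delta>s C B \<in> {\<delta>s C A, s \<otimes>\<^bsub>W\<^esub> \<delta>s C A}"
        using codist_step[OF C step(1,2)] J generate.incl[of s J W] by auto
      then show ?case using step(5) by auto
    qed simp
    then have "\<delta>s C D \<in> ?G K" using wJ JK unfolding w_def by blast
    then have "\<delta>s C D \<otimes>\<^bsub>W\<^esub> \<delta>s D C = \<one>\<^bsub>W\<^esub>" "\<delta>s C D \<in> ?G K"
      using Tw1[OF C D(1)] codist_in[OF C D(1)] by auto
    \<comment> \<open>Seen from \<open>D\<close>, a walk from \<open>C\<close> inside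
      \<open>R\<close> may multiply the codistance \<open>\<delta>s D C\<close> by any element of
      \<open>?G K\<close>; its inverse \<open>\<delta>s C D\<close> is one, and yields
      \<open>\<one>\<close>.\<close>
    then obtain E where "E \<in> \<Delta> Plus" "\<delta> C E \<in> ?G K" "\<delta>s D E = \<one>\<^bsub>W\<^esub>"
      using codist_walk[OF K D(1), of C "\<delta>s C D"] C by auto
    then show ?thesis using D(1) unfolding R_def opposite_def by force
  qed
  moreover have "spherical_residue W S \<Delta> \<delta> R"
    unfolding spherical_residue_def using K fin R by blast
  moreover have "residue_in W S \<Delta> \<delta> Minus (\<theta> ` R)" "residue_in W S \<Delta> \<delta> (opp_sign Minus) R"
    unfolding residue_in_def using K J R \<theta>R_type by auto
  ultimately show ?thesis unfolding opposite_residues_def by blast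
qed

end
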